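(* Consider the Cartan matrices $$A=\begin{pmatrix}2&-1&0&-1\\-4&2&-1&0\\0&-1&2&-1\\-1&0&-2&2\end{pmatrix},\qquad B=\begin{pmatrix}2&-1&-1&0\\-1&2&-1&-1\\-1&-4&2&-1\\0&-2&-2&2\end{pmatrix}.$$ Their Poincaré series are $$P(A)=-\frac{(t^5+t^4+t^3+t^2+t+1)(t^3+t^2+t+1)(t+1)}{t^5+t^4+t^3+t^2+t-1},$$ $$P(B)=-\frac{(t^5+t^4+t^3+t^2+t+1)(t^3+t^2+t+1)(t+1)}{t^7+t^6+2t^5+2t^4+2t^3+2t^2+t-1},$$ so that $\deg P(A)=4$ and $\deg P(B)=2$. Consequently $A$ and $B$ are counterexamples to the conjecture of Chapavalov, Leites and Stekolshchik that the Poincaré series of every infinite dimensional Kac-Moody Lie algebra $g(M)$ with connected Coxeter graph satisfies $0\le\deg P(M)\le 1$.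
   Context: A Cartan matrix is an $n\times n$ integer matrix $M=(a_{ij})$ with $a_{ii}=2$ for all $i$, $a_{ij}\le 0$ for $i\ne j$, and $a_{ij}=0\Rightarrow a_{ji}=0$. Its Weyl group is the Coxeter group $W(M)=\langle \sigma_1,\dots,\sigma_n \mid \sigma_i^2=1,\ (\sigma_i\sigma_j)^{m_{ij}}=1\ (i\ne j)\rangle$, where for $i\neq j$ one puts $m_{ij}=2,3,4,6,\infty$ according as $a_{ij}a_{ji}=0,1,2,3,\ge 4$ respectively (no relation if $m_{ij}=\infty$). The Coxeter graph has vertices $1,\dots,n$, with $i\ne j$ joined iff $a_{ij}\neq 0$. The Kac-Moody Lie algebra $g(M)$ is infinite dimensional iff $W(M)$ is infinite. Let $l(w)$ be the length of $w\in W(M)$ with respect to the generators. The Poincaré series is $P(M)=\sum_{w\in W(M)}t^{l(w)}$, which is a rational function of $t$. For a rational function $P=Q/R$ with $Q,R$ polynomials, $\deg P=\deg Q-\deg R$. *)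

theory Defs
  imports
    "Jordan_Normal_Form.Matrix"
    "HOL-Algebra.Group"
    "HOL-Library.Poly_Mapping"
    "HOL-Library.Extended_Nat"
    "HOL-Computational_Algebra.Polynomial_FPS"
begin

text \<open>Indices run over \<open>0, \<dots>, n - 1\<close> instead of \<open>1, \<dots>, n\<close>, following the matrix library.\<close>

section \<open>Cartan matrices and Coxeter graphs\<close>

definition cartan_matrix :: "int mat \<Rightarrow> bool" where
  "cartan_matrix M \<longleftrightarrow> square_mat M \<and>
     (\<forall>i < dim_row M. M $$ (i, i) = 2) \<and>
     (\<forall>i < dim_row M. \<forall>j < dim_row M. i \<noteq> j \<longrightarrow> M $$ (i, j) \<le> 0) \<and>
     (\<forall>i < dim_row M. \<forall>j < dim_row M. M $$ (i, j) = 0 \<longrightarrow> M $$ (j, i) = 0)"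

definition coxeter_edges :: "int mat \<Rightarrow> (nat \<times> nat) set" where
  "coxeter_edges M =
     {(i, j). i < dim_row M \<and> j < dim_row M \<and> i \<noteq> j \<and> M $$ (i, j) \<noteq> 0}"

definition connected_coxeter_graph :: "int mat \<Rightarrow> bool" where
  "connected_coxeter_graph M \<longleftrightarrow>
     (\<forall>i < dim_row M. \<forall>j < dim_row M. (i, j) \<in> (coxeter_edges M)\<^sup>*)"

section \<open>The Weyl group\<close>

definition coxeter_exponent :: "int mat \<Rightarrow> nat \<Rightarrow> nat \<Rightarrow> enat" where
  "coxeter_exponent M i j =
     (let p = M $$ (i, j) * M $$ (j, i) in
      if p = 0 then 2 else if p = 1 then 3 else if p = 2 then 4 else if p = 3 then 6 else \<infinity>)"

text \<open>
  Since the relations make every generator its own inverse, elements of the group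
  \<open>W(M)\<close> are represented by words in the generators alone, without formal inverses;
  \<open>weyl_eq M\<close> is the congruence on words generated by the defining relations.
\<close>

inductive weyl_eq :: "int mat \<Rightarrow> nat list \<Rightarrow> nat list \<Rightarrow> bool" for M where
  square: "i < dim_row M \<Longrightarrow> weyl_eq M [i, i] []"
| braid: "i < dim_row M \<Longrightarrow> j < dim_row M \<Longrightarrow> i \<noteq> j \<Longrightarrow> coxeter_exponent M i j = enat m \<Longrightarrow>
    weyl_eq M (concat (replicate m [i, j])) []"
| refl: "u \<in> lists {..<dim_row M} \<Longrightarrow> weyl_eq M u u"
| sym: "weyl_eq M u v \<Longrightarrow> weyl_eq M v u"
| trans: "weyl_eq M u v \<Longrightarrow> weyl_eq M v w \<Longrightarrow> weyl_eq M u w"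
| append: "weyl_eq M u u' \<Longrightarrow> weyl_eq M v v' \<Longrightarrow> weyl_eq M (u @ v) (u' @ v')"

definition weyl_class :: "int mat \<Rightarrow> nat list \<Rightarrow> nat list set" where
  "weyl_class M u = {v. weyl_eq M u v}"

definition weyl_group :: "int mat \<Rightarrow> nat list set monoid" where
  "weyl_group M =
     \<lparr>carrier = weyl_class M ` lists {..<dim_row M},
      mult = (\<lambda>X Y. \<Union>u\<in>X. \<Union>v\<in>Y. weyl_class M (u @ v)),
      one = weyl_class M []\<rparr>"

definition weyl_generators :: "int mat \<Rightarrow> nat list set set" where
  "weyl_generators M = (\<lambda>i. weyl_class M [i]) ` {..<dim_row M}"

definition weyl_length :: "int mat \<Rightarrow> nat list set \<Rightarrow> nat" where
  "weyl_length M w =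
     (LEAST k. \<exists>xs. length xs = k \<and> set xs \<subseteq> weyl_generators M \<and>
        foldr (mult (weyl_group M)) xs (one (weyl_group M)) = w)"

lemma weyl_eq_lists:
  "weyl_eq M u v \<Longrightarrow> u \<in> lists {..<dim_row M} \<and> v \<in> lists {..<dim_row M}"
  by (induction rule: weyl_eq.induct) (auto simp: in_lists_conv_set)

lemma weyl_class_eqI: "weyl_eq M u v \<Longrightarrow> weyl_class M u = weyl_class M v"
  unfolding weyl_class_def by (blast intro: weyl_eq.sym weyl_eq.trans)

lemma weyl_class_eq_iff:
  assumes u: "u \<in> lists {..<dim_row M}"
  shows "weyl_class M u = weyl_class M v \<longleftrightarrow> weyl_eq M u v"
proof
  assume eq: "weyl_class M u = weyl_class M v"
  have "u \<in> weyl_class M v"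
    unfolding eq[symmetric] by (simp add: weyl_class_def weyl_eq.refl[OF u])
  then show "weyl_eq M u v"
    unfolding weyl_class_def by (simp add: weyl_eq.sym)
qed (rule weyl_class_eqI)

lemma weyl_mult_class:
  assumes "u \<in> lists {..<dim_row M}" "v \<in> lists {..<dim_row M}"
  shows "mult (weyl_group M) (weyl_class M u) (weyl_class M v) = weyl_class M (u @ v)"
proof -
  have eq: "weyl_class M (u' @ v') = weyl_class M (u @ v)"
    if "u' \<in> weyl_class M u" "v' \<in> weyl_class M v" for u' v'
  proof (rule weyl_class_eqI, rule weyl_eq.sym, rule weyl_eq.append)
    show "weyl_eq M u u'" "weyl_eq M v v'"
      using that by (simp_all add: weyl_class_def)
  qed
  have "u \<in> weyl_class M u" "v \<in> weyl_class M v"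
    using assms by (auto simp: weyl_class_def intro: weyl_eq.refl)
  with eq show ?thesis
    unfolding weyl_group_def monoid.simps by blast
qed

lemma weyl_eq_rev_append:
  "u \<in> lists {..<dim_row M} \<Longrightarrow> weyl_eq M (rev u @ u) []"
proof (induction u)
  case Nil
  then show ?case by (simp add: weyl_eq.refl)
next
  case (Cons a u)
  have u: "u \<in> lists {..<dim_row M}" "a < dim_row M" "rev u \<in> lists {..<dim_row M}"
    using Cons.prems by (auto simp: in_lists_conv_set)
  have "weyl_eq M (rev u @ ([a, a] @ u)) (rev u @ ([] @ u))"
    by (intro weyl_eq.append weyl_eq.refl weyl_eq.square u)
  then show ?case
    using weyl_eq.trans[OF _ Cons.IH[OF u(1)]] by simp
qed

lemma group_weyl_group: "group (weyl_group M)"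
proof (rule groupI)
  have carr: "carrier (weyl_group M) = weyl_class M ` lists {..<dim_row M}"
    and one: "one (weyl_group M) = weyl_class M []"
    by (simp_all add: weyl_group_def)
  show "one (weyl_group M) \<in> carrier (weyl_group M)"
    unfolding carr one by blast
  fix x assume "x \<in> carrier (weyl_group M)"
  then obtain u where u: "u \<in> lists {..<dim_row M}" "x = weyl_class M u"
    unfolding carr by blast
  show "mult (weyl_group M) (one (weyl_group M)) x = x"
    unfolding one u(2) by (subst weyl_mult_class) (use u in auto)
  have r: "rev u \<in> lists {..<dim_row M}"
    using u by (auto simp: in_lists_conv_set)
  have "mult (weyl_group M) (weyl_class M (rev u)) x = one (weyl_group M)"
    unfolding one u(2) weyl_mult_class[OF r u(1)]
    by (rule weyl_class_eqI, rule weyl_eq_rev_append, rule u(1))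
  then show "\<exists>y \<in> carrier (weyl_group M). mult (weyl_group M) y x = one (weyl_group M)"
    unfolding carr using r by blast
  fix y assume "y \<in> carrier (weyl_group M)"
  then obtain v where v: "v \<in> lists {..<dim_row M}" "y = weyl_class M v"
    unfolding carr by blast
  show "mult (weyl_group M) x y \<in> carrier (weyl_group M)"
    unfolding u(2) v(2) weyl_mult_class[OF u(1) v(1)] carr using u v by auto
  fix z assume "z \<in> carrier (weyl_group M)"
  then obtain w where w: "w \<in> lists {..<dim_row M}" "z = weyl_class M w"
    unfolding carr by blast
  show "mult (weyl_group M) (mult (weyl_group M) x y) z =
        mult (weyl_group M) x (mult (weyl_group M) y z)"
    unfolding u(2) v(2) w(2) using u(1) v(1) w(1) by (simp add: weyl_mult_class)
qed

section \<open>Poincare series and degrees of rational functions\<close>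

definition poincare_series :: "int mat \<Rightarrow> rat fps" where
  "poincare_series M =
     Abs_fps (\<lambda>k. of_nat (card {w \<in> carrier (weyl_group M). weyl_length M w = k}))"

text \<open>A power series is (the expansion of) the rational function \<open>Q / R\<close> iff \<open>P * R = Q\<close>.\<close>

definition rational_degree :: "'a::field fps \<Rightarrow> int" where
  "rational_degree P =
     (THE d. \<exists>Q R. Q \<noteq> 0 \<and> R \<noteq> 0 \<and> P * fps_of_poly R = fps_of_poly Q \<and>
        d = int (Polynomial.degree Q) - int (Polynomial.degree R))"

lemma rational_degree_eqI:
  fixes P :: "'a::field fps"
  assumes "Q \<noteq> 0" "R \<noteq> 0" "P * fps_of_poly R = fps_of_poly Q"
  shows "rational_degree P = int (Polynomial.degree Q) - int (Polynomial.degree R)"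
  unfolding rational_degree_def
proof (rule the_equality)
  fix d
  assume "\<exists>Q R. Q \<noteq> 0 \<and> R \<noteq> 0 \<and> P * fps_of_poly R = fps_of_poly Q \<and>
        d = int (Polynomial.degree Q) - int (Polynomial.degree R)"
  then obtain Q' R' where *: "Q' \<noteq> 0" "R' \<noteq> 0" "P * fps_of_poly R' = fps_of_poly Q'"
    "d = int (Polynomial.degree Q') - int (Polynomial.degree R')" by blast
  have "fps_of_poly (Q * R') = fps_of_poly (Q' * R)"
    unfolding fps_of_poly_mult assms(3)[symmetric] *(3)[symmetric] by (simp add: mult_ac)
  then have "Q * R' = Q' * R" by simp
  then have "Polynomial.degree (Q * R') = Polynomial.degree (Q' * R)" by simp
  then show "d = int (Polynomial.degree Q) - int (Polynomial.degree R)"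
    using assms * by (simp add: degree_mult_eq)
qed (use assms in blast)

section \<open>Lie algebras given by generators and relations\<close>

text \<open>
  The Lie algebra over the complex numbers presented by generators \<open>G\<close> and relators \<open>R\<close>
  is the quotient of the free nonassociative algebra on \<open>G\<close>, whose basis consists of the
  bracketed words in \<open>G\<close>, by the ideal generated by \<open>R\<close> and the Lie algebra identities.
\<close>

datatype 'a bracket_word = Letter 'a | Bracket "'a bracket_word" "'a bracket_word"

type_synonym 'a nonassoc = "'a bracket_word \<Rightarrow>\<^sub>0 complex"

definition free_nonassoc :: "'a set \<Rightarrow> 'a nonassoc set" where
  "free_nonassoc G = {p. \<forall>w \<in> Poly_Mapping.keys p. set_bracket_word w \<subseteq> G}"

definition letter :: "'a \<Rightarrow> 'a nonassoc" where
  "letter g = Poly_Mapping.single (Letter g) 1"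

definition scale :: "complex \<Rightarrow> 'a nonassoc \<Rightarrow> 'a nonassoc" where
  "scale c p = Poly_Mapping.map ((*) c) p"

definition bracket :: "'a nonassoc \<Rightarrow> 'a nonassoc \<Rightarrow> 'a nonassoc" where
  "bracket p q =
     (\<Sum>u \<in> Poly_Mapping.keys p. \<Sum>v \<in> Poly_Mapping.keys q.
        Poly_Mapping.single (Bracket u v) (Poly_Mapping.lookup p u * Poly_Mapping.lookup q v))"

inductive_set lie_ideal :: "'a set \<Rightarrow> 'a nonassoc set \<Rightarrow> 'a nonassoc set" for G R where
  relator: "r \<in> R \<Longrightarrow> r \<in> lie_ideal G R"
| alternating: "x \<in> free_nonassoc G \<Longrightarrow> bracket x x \<in> lie_ideal G R"
| jacobi: "x \<in> free_nonassoc G \<Longrightarrow> y \<in> free_nonassoc G \<Longrightarrow> z \<in> free_nonassoc G \<Longrightarrow>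
    bracket x (bracket y z) + bracket y (bracket z x) + bracket z (bracket x y) \<in> lie_ideal G R"
| zero: "0 \<in> lie_ideal G R"
| add: "a \<in> lie_ideal G R \<Longrightarrow> b \<in> lie_ideal G R \<Longrightarrow> a + b \<in> lie_ideal G R"
| scale: "a \<in> lie_ideal G R \<Longrightarrow> scale c a \<in> lie_ideal G R"
| bracket_left: "a \<in> lie_ideal G R \<Longrightarrow> x \<in> free_nonassoc G \<Longrightarrow> bracket x a \<in> lie_ideal G R"
| bracket_right: "a \<in> lie_ideal G R \<Longrightarrow> x \<in> free_nonassoc G \<Longrightarrow> bracket a x \<in> lie_ideal G R"

definition presented_lie_algebra_finite_dim :: "'a set \<Rightarrow> 'a nonassoc set \<Rightarrow> bool" where
  "presented_lie_algebra_finite_dim G R \<longleftrightarrow>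
     (\<exists>S. finite S \<and> S \<subseteq> free_nonassoc G \<and>
        (\<forall>x \<in> free_nonassoc G. \<exists>c. x - (\<Sum>s \<in> S. scale (c s) s) \<in> lie_ideal G R))"

section \<open>Kac-Moody Lie algebras\<close>

text \<open>
  The Kac-Moody Lie algebra \<open>g(M)\<close> is taken to be given by the Chevalley generators
  \<open>e\<^sub>i, f\<^sub>i, h\<^sub>i\<close> and the Chevalley-Serre relations. Enlarging the span of the \<open>h\<^sub>i\<close> to a
  realization of \<open>M\<close>, as is also customary, only changes \<open>g(M)\<close> by finitely many dimensions.
\<close>

datatype chevalley_generator = E nat | F nat | H nat

definition km_generators :: "int mat \<Rightarrow> chevalley_generator set" where
  "km_generators M = E ` {..<dim_row M} \<union> F ` {..<dim_row M} \<union> H ` {..<dim_row M}"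

inductive_set km_relators :: "int mat \<Rightarrow> chevalley_generator nonassoc set" for M where
  HH: "i < dim_row M \<Longrightarrow> j < dim_row M \<Longrightarrow>
    bracket (letter (H i)) (letter (H j)) \<in> km_relators M"
| EF_same: "i < dim_row M \<Longrightarrow>
    bracket (letter (E i)) (letter (F i)) - letter (H i) \<in> km_relators M"
| EF_distinct: "i < dim_row M \<Longrightarrow> j < dim_row M \<Longrightarrow> i \<noteq> j \<Longrightarrow>
    bracket (letter (E i)) (letter (F j)) \<in> km_relators M"
| HE: "i < dim_row M \<Longrightarrow> j < dim_row M \<Longrightarrow>
    bracket (letter (H i)) (letter (E j)) - scale (of_int (M $$ (i, j))) (letter (E j))
      \<in> km_relators M"
| HF: "i < dim_row M \<Longrightarrow> j < dim_row M \<Longrightarrow>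
    bracket (letter (H i)) (letter (F j)) + scale (of_int (M $$ (i, j))) (letter (F j))
      \<in> km_relators M"
| serre_E: "i < dim_row M \<Longrightarrow> j < dim_row M \<Longrightarrow> i \<noteq> j \<Longrightarrow>
    (bracket (letter (E i)) ^^ nat (1 - M $$ (i, j))) (letter (E j)) \<in> km_relators M"
| serre_F: "i < dim_row M \<Longrightarrow> j < dim_row M \<Longrightarrow> i \<noteq> j \<Longrightarrow>
    (bracket (letter (F i)) ^^ nat (1 - M $$ (i, j))) (letter (F j)) \<in> km_relators M"

definition kac_moody_infinite_dim :: "int mat \<Rightarrow> bool" where
  "kac_moody_infinite_dim M \<longleftrightarrow>
     \<not> presented_lie_algebra_finite_dim (km_generators M) (km_relators M)"

section \<open>The conjecture of Chapovalov, Leites and Stekolshchik\<close>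

definition CLS_conjecture :: bool where
  "CLS_conjecture \<longleftrightarrow>
     (\<forall>M. cartan_matrix M \<and> kac_moody_infinite_dim M \<and> connected_coxeter_graph M \<longrightarrow>
        0 \<le> rational_degree (poincare_series M) \<and> rational_degree (poincare_series M) \<le> 1)"

definition CLS_counterexample :: "int mat \<Rightarrow> bool" where
  "CLS_counterexample M \<longleftrightarrow>
     cartan_matrix M \<and> kac_moody_infinite_dim M \<and> connected_coxeter_graph M \<and>
     \<not> (0 \<le> rational_degree (poincare_series M) \<and> rational_degree (poincare_series M) \<le> 1)"

definition matrix_A :: "int mat" where
  "matrix_A = mat_of_rows_list 4
     [[ 2, -1,  0, -1],
      [-4,  2, -1,  0],
      [ 0, -1,  2, -1],
      [-1,  0, -2,  2]]"

definition matrix_B :: "int mat" where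
  "matrix_B = mat_of_rows_list 4
     [[ 2, -1, -1,  0],
      [-1,  2, -1, -1],
      [-1, -4,  2, -1],
      [ 0, -2, -2,  2]]"

end

theory Submission
  imports Defs
begin

text \<open>
  Number the generators of the Weyl groups from 0 to 3. In both matrices exactly one pair of
  generators has a product of infinite order: \<open>0, 1\<close> for \<open>A\<close> and \<open>1, 2\<close> for \<open>B\<close>. Removing either
  member of the pair leaves a Coxeter group of type \<open>B\<^sub>3\<close>, with Poincare series \<open>[2][4][6]\<close> where
  \<open>[k] = 1 + t + \<dots> + t\<^sup>k\<^sup>-\<^sup>1\<close>, and removing both leaves the dihedral group of order 8, with series
  \<open>[2][4]\<close>, in the case of \<open>A\<close>, and a group of order 4, with series \<open>[2]\<^sup>2\<close>, in the case of \<open>B\<close>.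
  Since every relator lives in one of the two groups of type \<open>B\<^sub>3\<close>, the Weyl group is their
  amalgamated product over the intersection, and its Poincare series \<open>P\<close> satisfies
  \<open>1 / P = 2 / ([2][4][6]) - 1 / P\<^sub>0\<close> with \<open>P\<^sub>0\<close> the series of the intersection. This gives the two
  rational functions, of degrees 4 and 2.

  The amalgamation formula \<open>poincare_amalgam\<close> is obtained from normal forms. Coset tables for the
  intersection in the two factors define an action of the generators on formal normal forms;
  checking the relators on the tables turns it into an action of the group (\<open>weyl_eq_act\<close>), which
  proves normal forms to be unique, while \<open>word_act\<close> proves that every element has one and that
  it is reduced. The tables are verified in \<open>path_table\<close> and \<open>middle_table\<close> by rewriting.

  For the counterexamples it remains to see that the Kac-Moody algebras have infinite dimension.
  In a finite dimensional one, a bracket of the \<open>e\<^sub>i\<close> of maximal height would have a weight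
  \<open>p = \<Sum> p\<^sub>j \<alpha>\<^sub>j\<close> with \<open>p \<ge> 0\<close>, \<open>p \<noteq> 0\<close> and, by \<open>sl\<^sub>2\<close>-theory, \<open>M p \<ge> 0\<close>
  (\<open>kac_moody_infinite_dimI\<close>). For both matrices there is no such \<open>p\<close>. The argument requires that
  the \<open>e\<^sub>i\<close> do not vanish in the algebra given by the Chevalley-Serre presentation, which is shown by
  constructing an irreducible highest weight module (\<open>annihilates_lie_ideal\<close>).
\<close>


section \<open>Linear operators\<close>

text \<open>
  The representation space consists of all functions on words, because it carries the operators
  below without any support condition. Linear operators on it are made a ring so that
  commutator identities become ring identities.
\<close>

typedef linop = "{A :: (nat list \<Rightarrow> complex) \<Rightarrow> nat list \<Rightarrow> complex.
    \<forall>a x y. A (\<lambda>w. a * x w + y w) = (\<lambda>w. a * A x w + A y w)}"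
  morphisms ap Linop
  by (rule exI[of _ "\<lambda>x. x"]) simp

setup_lifting type_definition_linop

lemma ap_lin: "ap A (\<lambda>w. a * x w + y w) = (\<lambda>w. a * ap A x w + ap A y w)"
  using ap[of A] by blast

lemma ap_add: "ap A (\<lambda>w. x w + y w) = (\<lambda>w. ap A x w + ap A y w)"
  using ap_lin[of A 1 x y] by simp

lemma ap_zero [simp]: "ap A (\<lambda>w. 0) = (\<lambda>w. 0)"
proof
  fix w
  show "ap A (\<lambda>w. 0) w = 0"
    using fun_cong[OF ap_lin[of A 1 "\<lambda>_. 0" "\<lambda>_. 0"], of w] by simp
qed

lemma ap_cmult: "ap A (\<lambda>w. a * x w) = (\<lambda>w. a * ap A x w)"
  using ap_lin[of A a x "\<lambda>_. 0"] by simp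

instantiation linop :: ring_1
begin

lift_definition zero_linop :: linop is "\<lambda>x w. 0" by simp
lift_definition one_linop :: linop is "\<lambda>x. x" by simp
lift_definition plus_linop :: "linop \<Rightarrow> linop \<Rightarrow> linop" is "\<lambda>A B x w. A x w + B x w"
  by (simp add: algebra_simps)
lift_definition minus_linop :: "linop \<Rightarrow> linop \<Rightarrow> linop" is "\<lambda>A B x w. A x w - B x w"
  by (simp add: algebra_simps)
lift_definition uminus_linop :: "linop \<Rightarrow> linop" is "\<lambda>A x w. - A x w"
  by simp
lift_definition times_linop :: "linop \<Rightarrow> linop \<Rightarrow> linop" is "\<lambda>A B x. A (B x)"
  by simp

instance
proof
  fix A B C :: linop
  show "(A + B) * C = A * C + B * C"
    by transfer simp
  show "A * (B + C) = A * B + A * C"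
    by (simp add: ap_inject[symmetric] times_linop.rep_eq plus_linop.rep_eq ap_add fun_eq_iff)
  show "(0::linop) \<noteq> 1"
  proof
    assume "(0::linop) = 1"
    then have "ap 0 (\<lambda>w. 1) [] = ap 1 (\<lambda>w. 1) []" by simp
    then show False by (simp add: zero_linop.rep_eq one_linop.rep_eq)
  qed
qed (transfer, simp add: fun_eq_iff)+

end

lift_definition scal :: "complex \<Rightarrow> linop" is "\<lambda>c x w. c * x w"
  by (simp add: algebra_simps)

lemmas ap_simps = zero_linop.rep_eq one_linop.rep_eq plus_linop.rep_eq minus_linop.rep_eq
  uminus_linop.rep_eq times_linop.rep_eq scal.rep_eq

lemma linop_eqI: "(\<And>x w. ap A x w = ap B x w) \<Longrightarrow> A = B"
  by (metis ap_inject ext)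

lemma scal_add: "scal (a + b) = scal a + scal b"
  by (rule linop_eqI) (simp add: ap_simps algebra_simps)

lemma scal_0 [simp]: "scal 0 = 0"
  by (rule linop_eqI) (simp add: ap_simps)

lemma scal_1 [simp]: "scal 1 = 1"
  by (rule linop_eqI) (simp add: ap_simps)

lemma scal_uminus: "scal (- a) = - scal a"
  by (rule linop_eqI) (simp add: ap_simps)

lemma scal_mult: "scal (a * b) = scal a * scal b"
  by (rule linop_eqI) (simp add: ap_simps)

lemma scal_commute: "A * scal a = scal a * A"
  by (rule linop_eqI) (simp add: ap_simps ap_cmult)

lemma scal_diff: "scal (a - b) = scal a - scal b"
  by (rule linop_eqI) (simp add: ap_simps algebra_simps)

lemma scal_of_int: "scal (of_int n) = of_int n"
proof -
  have "scal (of_nat k) = of_nat k" for k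
    by (induction k) (simp_all add: scal_add)
  then show ?thesis
    by (cases n rule: int_diff_cases) (simp add: scal_diff)
qed

lemma ap_sum: "ap (\<Sum>i\<in>I. f i) x w = (\<Sum>i\<in>I. ap (f i) x w)"
  by (induction I rule: infinite_finite_induct) (simp_all add: ap_simps)

section \<open>Commutators\<close>

definition ad :: "'a::ring_1 \<Rightarrow> 'a \<Rightarrow> 'a" where
  "ad a b = a * b - b * a"

text \<open>
  The Jacobi identity, in the form that \<open>ad a\<close> is a derivation of the commutator.
\<close>

lemma ad_ad: "ad a (ad b c) = ad (ad a b) c + ad b (ad a c)"
  by (simp add: ad_def algebra_simps)

lemma ad_of_int_right [simp]: "ad a (of_int n * b) = of_int n * ad a b"
proof -
  have "a * (of_int n * b) = of_int n * (a * b)"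
    by (metis mult.assoc mult_of_int_commute)
  then show ?thesis by (simp add: ad_def algebra_simps)
qed

lemma ad_of_int_left [simp]: "ad (of_int n * a) b = of_int n * ad a b"
proof -
  have "b * (of_int n * a) = of_int n * (b * a)"
    by (metis mult.assoc mult_of_int_commute)
  then show ?thesis by (simp add: ad_def algebra_simps)
qed

lemma ad_0 [simp]: "ad a 0 = 0" "ad 0 a = 0"
  by (simp_all add: ad_def)

lemma ad_self [simp]: "ad a a = 0"
  by (simp add: ad_def)

lemma ad_add_right: "ad a (b + c) = ad a b + ad a c"
  by (simp add: ad_def algebra_simps)

lemma ad_minus [simp]: "ad (- a) b = - ad a b" "ad a (- b) = - ad a b"
  by (simp_all add: ad_def)

lemma ad_swap: "ad a b = - ad b a"
  by (simp add: ad_def)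

lemma ad_pow_0 [simp]: "(ad a ^^ k) 0 = 0"
  by (induction k) simp_all

lemma sl2_weight:
  assumes "ad h f = of_int (- 2) * f" "ad h x = of_int m * x"
  shows "ad h ((ad f ^^ k) x) = of_int (m - 2 * int k) * (ad f ^^ k) x"
proof (induction k)
  case (Suc k)
  have "ad h ((ad f ^^ Suc k) x) = ad (of_int (- 2) * f) ((ad f ^^ k) x) +
      ad f (of_int (m - 2 * int k) * (ad f ^^ k) x)"
    unfolding funpow.simps comp_def ad_ad[of h] Suc.IH assms(1) ..
  also have "\<dots> = of_int (- 2) * (ad f ^^ Suc k) x + of_int (m - 2 * int k) * (ad f ^^ Suc k) x"
    unfolding ad_of_int_left ad_of_int_right by simp
  also have "\<dots> = of_int (m - 2 * int (Suc k)) * (ad f ^^ Suc k) x"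
    by (simp only: distrib_right[symmetric] of_int_add[symmetric]) (simp add: algebra_simps)
  finally show ?case .
qed (use assms in simp)

text \<open>
  The computation with an \<open>sl\<^sub>2\<close>-triple that carries the whole argument on Lie algebras. It is an
  exact identity, for an \<open>x\<close> that need not be killed by \<open>ad e\<close>, so that it can be used modulo
  the operators vanishing on a submodule.
\<close>

lemma sl2_raise:
  assumes ef: "ad e f = h" and hf: "ad h f = of_int (- 2) * f" and hx: "ad h x = of_int m * x"
  shows "ad e ((ad f ^^ k) x) =
    of_int (int k * (m - int k + 1)) * (ad f ^^ (k - 1)) x + (ad f ^^ k) (ad e x)"
proof (induction k)
  case (Suc k)
  let ?y = "(ad f ^^ k) x"
  have *: "of_int (int k * (m - int k + 1)) * ad f ((ad f ^^ (k - 1)) x) =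
      of_int (int k * (m - int k + 1)) * ?y"
    by (cases k) simp_all
  have "ad e ((ad f ^^ Suc k) x) = ad h ?y + ad f (ad e ?y)"
    unfolding funpow.simps comp_def ad_ad[of e] ef ..
  also have "\<dots> = of_int (m - 2 * int k) * ?y + (of_int (int k * (m - int k + 1)) * ?y +
      (ad f ^^ Suc k) (ad e x))"
    unfolding sl2_weight[OF hf hx] Suc.IH ad_add_right ad_of_int_right * by simp
  also have "\<dots> = of_int ((m - 2 * int k) + int k * (m - int k + 1)) * ?y + (ad f ^^ Suc k) (ad e x)"
    by (simp only: of_int_add distrib_right add.assoc)
  also have "(m - 2 * int k) + int k * (m - int k + 1) = int (Suc k) * (m - int (Suc k) + 1)"
    by (simp add: algebra_simps)
  finally show ?case by simp
qed simp

lemma ad_pow_commute: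
  assumes "ad g f = 0"
  shows "ad g ((ad f ^^ k) y) = (ad f ^^ k) (ad g y)"
  by (induction k) (simp_all add: ad_ad[of g] assms)

text \<open>
  In a Serre element the exponent \<open>1 - a\<close> is the one at which the coefficient in
  \<open>sl2_raise\<close> vanishes.
\<close>

lemma serre_commute_same:
  assumes "ad e f = h" "ad h f = of_int (- 2) * f" "ad h y = of_int (- a) * y" "ad e y = 0" "a \<le> 0"
  shows "ad e ((ad f ^^ nat (1 - a)) y) = 0"
  using sl2_raise[OF assms(1-3), of "nat (1 - a)"] assms(4,5) by simp

lemma serre_commute_other:
  assumes "ad g f = 0" "ad g y = h" "ad f h = of_int b * f" "a \<le> 0" "a = 0 \<Longrightarrow> b = 0"
  shows "ad g ((ad f ^^ nat (1 - a)) y) = 0"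
proof (cases "a = 0")
  case True
  then show ?thesis using ad_pow_commute[OF assms(1), of 1 y] assms by simp
next
  case False
  then have "nat (1 - a) = Suc (Suc (nat (- 1 - a)))" using assms(4) by simp
  then have "(ad f ^^ nat (1 - a)) h = (ad f ^^ nat (- 1 - a)) (ad f (ad f h))"
    by (simp only: funpow_Suc_right comp_def)
  then show ?thesis
    by (simp add: ad_pow_commute[OF assms(1)] assms(2,3))
qed

section \<open>The contragredient Verma module\<close>

text \<open>
  Functions on words \<open>w = [i\<^sub>1, \<dots>, i\<^sub>k]\<close> in the simple roots are regarded as functionals on the
  Verma module whose highest weight takes the value 1 at each \<open>h\<^sub>i\<close>, the word \<open>w\<close> standing for the
  basis vector \<open>f\<^bsub>i\<^sub>1\<^esub> \<dots> f\<^bsub>i\<^sub>k\<^esub> v\<close>. The Lie algebra acts through the anti-involution that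
  exchanges \<open>e\<^sub>i\<close> and \<open>f\<^sub>i\<close>; so \<open>e\<^sub>i\<close> only prepends a letter, and \<open>f\<^sub>i\<close> is dual to moving \<open>e\<^sub>i\<close>
  past the letters. The number below is the eigenvalue of \<open>h\<^sub>i\<close> on \<open>w\<close>.
\<close>

definition h_value :: "int mat \<Rightarrow> nat \<Rightarrow> nat list \<Rightarrow> complex" where
  "h_value M i w = 1 - of_int (\<Sum>j\<leftarrow>w. M $$ (i, j))"

lemma h_value_Nil [simp]: "h_value M i [] = 1"
  and h_value_Cons: "h_value M i (j # w) = h_value M i w - of_int (M $$ (i, j))"
  by (simp_all add: h_value_def)

primrec lower :: "int mat \<Rightarrow> nat \<Rightarrow> nat list \<Rightarrow> (nat list \<Rightarrow> complex) \<Rightarrow> complex" where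
  "lower M j [] x = 0"
| "lower M j (i # w) x = lower M j w (\<lambda>v. x (i # v)) + (if i = j then h_value M j w * x w else 0)"

lemma lower_lin: "lower M j w (\<lambda>v. a * x v + y v) = a * lower M j w x + lower M j w y"
  by (induction w arbitrary: x y) (simp_all add: algebra_simps)

lift_definition opE :: "nat \<Rightarrow> linop" is "\<lambda>i x w. x (i # w)" by simp
lift_definition opF :: "int mat \<Rightarrow> nat \<Rightarrow> linop" is "\<lambda>M j x w. lower M j w x"
  by (simp add: lower_lin)
lift_definition opH :: "int mat \<Rightarrow> nat \<Rightarrow> linop" is "\<lambda>M i x w. h_value M i w * x w"
  by (simp add: algebra_simps)

lemmas op_simps = opE.rep_eq opF.rep_eq opH.rep_eq

lemma ap_of_int: "ap (of_int n) x w = of_int n * x w"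
  by (simp flip: scal_of_int add: ap_simps)

lemma ad_HH: "ad (opH M i) (opH M j) = 0"
  by (rule linop_eqI) (simp add: ad_def ap_simps op_simps)

lemma ad_HE: "ad (opH M i) (opE j) = of_int (M $$ (i, j)) * opE j"
  by (rule linop_eqI) (simp add: ad_def ap_simps ap_of_int op_simps h_value_Cons algebra_simps)

lemma ad_EF: "ad (opE i) (opF M j) = (if i = j then opH M i else 0)"
  by (rule linop_eqI) (simp add: ad_def ap_simps op_simps)

lemma lower_h_value:
  "lower M j w (\<lambda>v. h_value M i v * x v) = (h_value M i w + of_int (M $$ (i, j))) * lower M j w x"
proof (induction w arbitrary: x)
  case (Cons k w)
  have "(\<lambda>v. h_value M i (k # v) * x (k # v)) =
      (\<lambda>v. (- of_int (M $$ (i, k))) * x (k # v) + h_value M i v * x (k # v))"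
    by (simp add: h_value_Cons algebra_simps)
  then have "lower M j w (\<lambda>v. h_value M i (k # v) * x (k # v)) =
      (- of_int (M $$ (i, k))) * lower M j w (\<lambda>v. x (k # v))
        + (h_value M i w + of_int (M $$ (i, j))) * lower M j w (\<lambda>v. x (k # v))"
    by (simp only: lower_lin Cons.IH)
  then have "lower M j (k # w) (\<lambda>v. h_value M i v * x v) =
      (h_value M i w - of_int (M $$ (i, k)) + of_int (M $$ (i, j))) * lower M j w (\<lambda>v. x (k # v))
        + (if k = j then h_value M j w * (h_value M i w * x w) else 0)"
    by (simp only: lower.simps) (simp add: algebra_simps)
  then show ?case
    by (simp add: h_value_Cons) (simp add: algebra_simps)
qed simp

lemma ad_HF: "ad (opH M i) (opF M j) = of_int (- M $$ (i, j)) * opF M j"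
  by (rule linop_eqI)
    (simp add: ad_def ap_simps ap_of_int op_simps lower_h_value left_diff_distrib distrib_right
      del: of_int_minus, simp)

section \<open>The action of the free nonassociative algebra\<close>

primrec gen_op :: "int mat \<Rightarrow> chevalley_generator \<Rightarrow> linop" where
  "gen_op M (E i) = opE i"
| "gen_op M (F i) = opF M i"
| "gen_op M (H i) = opH M i"

primrec word_op :: "int mat \<Rightarrow> chevalley_generator bracket_word \<Rightarrow> linop" where
  "word_op M (Letter g) = gen_op M g"
| "word_op M (Bracket u v) = ad (word_op M u) (word_op M v)"

definition nonassoc_op :: "int mat \<Rightarrow> chevalley_generator nonassoc \<Rightarrow> linop" where
  "nonassoc_op M p = (\<Sum>w\<in>Poly_Mapping.keys p. scal (Poly_Mapping.lookup p w) * word_op M w)"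

text \<open>
  Summation over a common superset of the supports is what makes the action additive.
\<close>

lemma nonassoc_op_superset:
  assumes "finite A" "Poly_Mapping.keys p \<subseteq> A"
  shows "nonassoc_op M p = (\<Sum>w\<in>A. scal (Poly_Mapping.lookup p w) * word_op M w)"
  unfolding nonassoc_op_def
  by (rule sum.mono_neutral_left) (use assms in \<open>auto simp: not_in_keys_iff_lookup_eq_zero\<close>)

lemma nonassoc_op_add: "nonassoc_op M (p + q) = nonassoc_op M p + nonassoc_op M q"
proof -
  let ?A = "Poly_Mapping.keys p \<union> Poly_Mapping.keys q"
  have "Poly_Mapping.keys (p + q) \<subseteq> ?A" by (rule Poly_Mapping.keys_add)
  then show ?thesis
    by (subst (1 2 3) nonassoc_op_superset[of ?A])
       (auto simp: lookup_add scal_add algebra_simps sum.distrib)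
qed

lemma nonassoc_op_0 [simp]: "nonassoc_op M 0 = 0"
  by (simp add: nonassoc_op_def)

lemma nonassoc_op_uminus: "nonassoc_op M (- p) = - nonassoc_op M p"
  using nonassoc_op_add[of M p "- p"] by (simp add: eq_neg_iff_add_eq_0 add.commute)

lemma nonassoc_op_diff: "nonassoc_op M (p - q) = nonassoc_op M p - nonassoc_op M q"
  using nonassoc_op_add[of M p "- q"] by (simp add: nonassoc_op_uminus)

lemma nonassoc_op_sum: "nonassoc_op M (\<Sum>i\<in>I. f i) = (\<Sum>i\<in>I. nonassoc_op M (f i))"
  by (induction I rule: infinite_finite_induct) (simp_all add: nonassoc_op_add)

lemma nonassoc_op_single: "nonassoc_op M (Poly_Mapping.single w c) = scal c * word_op M w"
  by (simp add: nonassoc_op_def)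

lemma nonassoc_op_letter [simp]: "nonassoc_op M (letter g) = gen_op M g"
  by (simp add: letter_def nonassoc_op_single)

lemma nonassoc_op_scale: "nonassoc_op M (scale c p) = scal c * nonassoc_op M p"
proof -
  have "Poly_Mapping.keys (scale c p) \<subseteq> Poly_Mapping.keys p"
    by (auto simp: scale_def in_keys_iff Poly_Mapping.map.rep_eq when_def)
  then have "nonassoc_op M (scale c p) =
      (\<Sum>w\<in>Poly_Mapping.keys p. scal (Poly_Mapping.lookup (scale c p) w) * word_op M w)"
    by (intro nonassoc_op_superset) simp_all
  also have "\<dots> = (\<Sum>w\<in>Poly_Mapping.keys p. scal c * (scal (Poly_Mapping.lookup p w) * word_op M w))"
    by (rule sum.cong) (auto simp: scale_def Poly_Mapping.map.rep_eq in_keys_iff scal_mult mult.assoc)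
  finally show ?thesis
    by (simp add: nonassoc_op_def sum_distrib_left)
qed

lemma scal_mult_mult: "(scal a * A) * (scal b * B) = scal (a * b) * (A * B)"
  by (metis mult.assoc scal_commute scal_mult)

lemma nonassoc_op_bracket: "nonassoc_op M (bracket p q) = ad (nonassoc_op M p) (nonassoc_op M q)"
proof -
  let ?P = "Poly_Mapping.keys p" and ?Q = "Poly_Mapping.keys q"
  let ?p = "Poly_Mapping.lookup p" and ?q = "Poly_Mapping.lookup q"
  have "nonassoc_op M (bracket p q) =
      (\<Sum>u\<in>?P. \<Sum>v\<in>?Q. scal (?p u * ?q v) * ad (word_op M u) (word_op M v))"
    by (simp add: bracket_def nonassoc_op_sum nonassoc_op_single)
  also have "\<dots> = (\<Sum>u\<in>?P. \<Sum>v\<in>?Q. (scal (?p u) * word_op M u) * (scal (?q v) * word_op M v)) -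
      (\<Sum>u\<in>?P. \<Sum>v\<in>?Q. (scal (?q v) * word_op M v) * (scal (?p u) * word_op M u))"
    unfolding scal_mult_mult
    by (simp add: ad_def right_diff_distrib sum_subtractf mult.commute[of "?q _"])
  also have "(\<Sum>u\<in>?P. \<Sum>v\<in>?Q. (scal (?q v) * word_op M v) * (scal (?p u) * word_op M u)) =
      (\<Sum>v\<in>?Q. \<Sum>u\<in>?P. (scal (?q v) * word_op M v) * (scal (?p u) * word_op M u))"
    by (rule sum.swap)
  finally show ?thesis
    by (simp only: ad_def nonassoc_op_def sum_product)
qed

lemma nonassoc_op_bracket_pow:
  "nonassoc_op M ((bracket p ^^ k) q) = (ad (nonassoc_op M p) ^^ k) (nonassoc_op M q)"
  by (induction k) (simp_all add: nonassoc_op_bracket)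

section \<open>The submodule generated by the vacuum\<close>

text \<open>
  The span of the vectors \<open>f\<^bsub>i\<^sub>1\<^esub> \<dots> f\<^bsub>i\<^sub>k\<^esub> v\<close> for the highest weight functional \<open>v\<close>. It is the
  irreducible quotient of the Verma module, realized as a submodule of the dual.
\<close>

inductive_set verma :: "int mat \<Rightarrow> (nat list \<Rightarrow> complex) set" for M where
  vacuum: "(\<lambda>w. if w = [] then 1 else 0) \<in> verma M"
| lower: "x \<in> verma M \<Longrightarrow> ap (opF M i) x \<in> verma M"
| add: "x \<in> verma M \<Longrightarrow> y \<in> verma M \<Longrightarrow> (\<lambda>w. x w + y w) \<in> verma M"
| cmult: "x \<in> verma M \<Longrightarrow> (\<lambda>w. c * x w) \<in> verma M"

lemma verma_0: "(\<lambda>w. 0) \<in> verma M"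
  using verma.cmult[OF verma.vacuum, of 0] by simp

definition preserves :: "int mat \<Rightarrow> linop \<Rightarrow> bool" where
  "preserves M A \<longleftrightarrow> (\<forall>x\<in>verma M. ap A x \<in> verma M)"

text \<open>
  The Serre elements of the \<open>e\<^sub>i\<close> vanish only on the submodule, hence the relations are verified
  modulo the operators that annihilate it.
\<close>

definition annihilates :: "int mat \<Rightarrow> linop \<Rightarrow> bool" where
  "annihilates M A \<longleftrightarrow> (\<forall>x\<in>verma M. ap A x = (\<lambda>w. 0))"

lemma preserves_add: "preserves M A \<Longrightarrow> preserves M B \<Longrightarrow> preserves M (A + B)"
  by (simp add: preserves_def ap_simps verma.add)

lemma preserves_scal: "preserves M (scal c)"
  by (simp add: preserves_def ap_simps verma.cmult)

lemma preserves_mult: "preserves M A \<Longrightarrow> preserves M B \<Longrightarrow> preserves M (A * B)"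
  by (simp add: preserves_def ap_simps)

lemma preserves_uminus: "preserves M A \<Longrightarrow> preserves M (- A)"
  using preserves_mult[OF preserves_scal[of M "-1"]] by (simp add: scal_uminus)

lemma preserves_ad: "preserves M A \<Longrightarrow> preserves M B \<Longrightarrow> preserves M (ad A B)"
  unfolding ad_def diff_conv_add_uminus
  by (intro preserves_add preserves_uminus preserves_mult)

lemma preserves_0 [simp]: "preserves M 0"
  by (simp add: preserves_def ap_simps verma_0)

lemma preserves_sum: "(\<And>i. i \<in> I \<Longrightarrow> preserves M (f i)) \<Longrightarrow> preserves M (\<Sum>i\<in>I. f i)"
  by (induction I rule: infinite_finite_induct) (auto intro: preserves_add)

lemma annihilates_0 [simp]: "annihilates M 0"
  by (simp add: annihilates_def ap_simps)

lemma annihilates_add: "annihilates M A \<Longrightarrow> annihilates M B \<Longrightarrow> annihilates M (A + B)"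
  by (simp add: annihilates_def ap_simps)

lemma annihilates_diff: "annihilates M A \<Longrightarrow> annihilates M B \<Longrightarrow> annihilates M (A - B)"
  by (simp add: annihilates_def ap_simps)

lemma annihilates_mult_left: "annihilates M A \<Longrightarrow> annihilates M (B * A)"
  by (simp add: annihilates_def ap_simps)

lemma annihilates_mult_right: "annihilates M A \<Longrightarrow> preserves M B \<Longrightarrow> annihilates M (A * B)"
  by (simp add: annihilates_def preserves_def ap_simps)

lemma annihilates_ad:
  assumes "annihilates M A" "preserves M B"
  shows "annihilates M (ad B A)" "annihilates M (ad A B)"
  using assms
  by (auto simp: ad_def intro!: annihilates_diff intro: annihilates_mult_left annihilates_mult_right)

lemma annihilates_ad_pow:
  assumes "annihilates M A" "preserves M B"
  shows "annihilates M ((ad B ^^ k) A)"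
  by (induction k) (simp_all add: assms annihilates_ad)

lemma preserves_opF: "preserves M (opF M i)"
  by (simp add: preserves_def verma.lower)

lemma mult_eq_ad: "A * B = B * A + ad A B"
  by (simp add: ad_def)

text \<open>
  The submodule is defined through the \<open>f\<^sub>i\<close> alone; it is stable under \<open>h\<^sub>i\<close>, and then under \<open>e\<^sub>i\<close>,
  because their commutators with \<open>f\<^sub>j\<close> are known.
\<close>

lemma preserves_opH: "preserves M (opH M i)"
  unfolding preserves_def
proof
  fix x assume "x \<in> verma M"
  then show "ap (opH M i) x \<in> verma M"
  proof induction
    case vacuum
    have "ap (opH M i) (\<lambda>w. if w = [] then 1 else 0) = (\<lambda>w. if w = [] then 1 else 0)"
      by (auto simp: op_simps)
    then show ?case by (simp add: verma.vacuum)
  next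
    case (lower x j)
    have "ap (opH M i) (ap (opF M j) x) =
        (\<lambda>w. ap (opF M j) (ap (opH M i) x) w + of_int (- M $$ (i, j)) * ap (opF M j) x w)"
      using arg_cong[OF mult_eq_ad[of "opH M i" "opF M j", unfolded ad_HF], of "\<lambda>A. ap A x"]
      by (simp only: ap_simps ap_of_int[abs_def])
    then show ?case by (simp only:) (intro verma.add verma.cmult verma.lower lower)
  qed (simp_all add: ap_add ap_cmult verma.add verma.cmult)
qed

lemma preserves_opE: "preserves M (opE i)"
  unfolding preserves_def
proof
  fix x assume "x \<in> verma M"
  then show "ap (opE i) x \<in> verma M"
  proof induction
    case (lower x j)
    have "ap (opE i) (ap (opF M j) x) =
        (\<lambda>w. ap (opF M j) (ap (opE i) x) w + ap (if i = j then opH M i else 0) x w)"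
      using arg_cong[OF mult_eq_ad[of "opE i" "opF M j", unfolded ad_EF], of "\<lambda>A. ap A x"]
      by (simp only: ap_simps)
    moreover have "ap (if i = j then opH M i else 0) x \<in> verma M"
      using lower.hyps preserves_opH[of M] by (auto simp: preserves_def ap_simps verma_0)
    ultimately show ?case using lower by (auto intro: verma.intros)
  qed (simp_all add: op_simps verma_0 ap_add ap_cmult verma.add verma.cmult)
qed

lemma preserves_word_op: "preserves M (word_op M w)"
proof (induction w)
  case (Letter g)
  then show ?case by (cases g) (simp_all add: preserves_opE preserves_opF preserves_opH)
qed (simp add: preserves_ad)

lemma preserves_nonassoc_op: "preserves M (nonassoc_op M p)"
  unfolding nonassoc_op_def
  by (intro preserves_sum preserves_mult preserves_scal preserves_word_op)

section \<open>The Serre relations\<close>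

text \<open>
  Evaluating at a word amounts to applying raising operators and then evaluating at the empty
  word. An operator that commutes with the raising operators is therefore determined by its
  values at the empty word; this settles the Serre relations of the \<open>f\<^sub>i\<close>.
\<close>

lemma eq_0_if_commutes_raising:
  assumes comm: "\<And>k. ad (opE k) A = 0" and top: "\<And>x. ap A x [] = 0"
  shows "A = 0"
proof (rule linop_eqI)
  fix x w show "ap A x w = ap 0 x w"
  proof (induction w arbitrary: x)
    case (Cons k w)
    have "opE k * A = A * opE k" using comm[of k] by (simp add: ad_def)
    then have "ap A x (k # w) = ap A (ap (opE k) x) w"
      by (metis opE.rep_eq times_linop.rep_eq)
    then show ?case by (simp add: Cons.IH ap_simps)
  qed (simp add: top ap_simps)
qed

text \<open>
  The dual principle, on the module generated by the vacuum under the lowering operators; it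
  settles the Serre relations of the \<open>e\<^sub>i\<close>.
\<close>

lemma annihilates_if_commutes_lowering:
  assumes comm: "\<And>k. ad (opF M k) A = 0" and vac: "ap A (\<lambda>w. if w = [] then 1 else 0) = (\<lambda>w. 0)"
  shows "annihilates M A"
  unfolding annihilates_def
proof
  fix x assume "x \<in> verma M"
  then show "ap A x = (\<lambda>w. 0)"
  proof induction
    case (lower x i)
    have "opF M i * A = A * opF M i" using comm[of i] by (simp add: ad_def)
    then have "ap A (ap (opF M i) x) = ap (opF M i) (ap A x)"
      by (metis times_linop.rep_eq)
    then show ?case by (simp add: lower)
  qed (simp_all add: vac ap_add ap_cmult)
qed

lemma serre_F_op:
  assumes M: "cartan_matrix M" and ij: "i < dim_row M" "j < dim_row M" "i \<noteq> j"
  shows "(ad (opF M i) ^^ nat (1 - M $$ (i, j))) (opF M j) = 0"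
proof (rule eq_0_if_commutes_raising)
  have a: "M $$ (i, j) \<le> 0" "M $$ (i, j) = 0 \<Longrightarrow> M $$ (j, i) = 0" "M $$ (i, i) = 2"
    using M ij by (auto simp: cartan_matrix_def)
  fix k
  consider "k = i" | "k = j" | "k \<noteq> i" "k \<noteq> j" by blast
  then show "ad (opE k) ((ad (opF M i) ^^ nat (1 - M $$ (i, j))) (opF M j)) = 0"
  proof cases
    case 1
    show ?thesis unfolding 1
      by (rule serre_commute_same[where h = "opH M i"]) (use a ij in \<open>simp_all add: ad_EF ad_HF\<close>)
  next
    case 2
    show ?thesis unfolding 2
      by (rule serre_commute_other[where h = "opH M j" and b = "M $$ (j, i)"])
        (use a ij in \<open>simp_all add: ad_EF ad_HF ad_swap[of "opF M i" "opH M j"]\<close>)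
  next
    case 3
    then show ?thesis by (simp add: ad_pow_commute ad_EF)
  qed
next
  fix x
  show "ap ((ad (opF M i) ^^ nat (1 - M $$ (i, j))) (opF M j)) x [] = 0"
  proof -
    have "ap ((ad (opF M i) ^^ k) (opF M j)) x [] = 0" for k x
      by (induction k arbitrary: x) (simp_all add: ap_simps op_simps ad_def)
    then show ?thesis .
  qed
qed

lemma serre_E_op:
  assumes M: "cartan_matrix M" and ij: "i < dim_row M" "j < dim_row M" "i \<noteq> j"
  shows "annihilates M ((ad (opE i) ^^ nat (1 - M $$ (i, j))) (opE j))"
proof (rule annihilates_if_commutes_lowering)
  have a: "M $$ (i, j) \<le> 0" "M $$ (i, j) = 0 \<Longrightarrow> M $$ (j, i) = 0" "M $$ (i, i) = 2"
    using M ij by (auto simp: cartan_matrix_def)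
  have FE: "ad (opF M k) (opE l) = (if l = k then - opH M l else 0)" for k l
    by (subst ad_swap) (simp add: ad_EF)
  fix k
  consider "k = i" | "k = j" | "k \<noteq> i" "k \<noteq> j" by blast
  then show "ad (opF M k) ((ad (opE i) ^^ nat (1 - M $$ (i, j))) (opE j)) = 0"
  proof cases
    case 1
    show ?thesis unfolding 1
      by (rule serre_commute_same[where h = "- opH M i"]) (use a ij in \<open>simp_all add: FE ad_HE\<close>)
  next
    case 2
    show ?thesis unfolding 2
      by (rule serre_commute_other[where h = "- opH M j" and b = "M $$ (j, i)"])
        (use a ij in \<open>simp_all add: FE ad_HE ad_swap[of "opE i" "opH M j"]\<close>)
  next
    case 3
    then show ?thesis by (simp add: ad_pow_commute FE)
  qed
next
  have "ap ((ad (opE i) ^^ k) (opE j)) (\<lambda>w. if w = [] then 1 else 0) = (\<lambda>w. 0)" for k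
  proof (induction k)
    case (Suc k)
    have "ap (opE i) (\<lambda>w. if w = [] then 1 else 0) = (\<lambda>w. 0)"
      by (simp add: op_simps)
    then show ?case using Suc by (simp add: ap_simps ad_def)
  qed (simp add: op_simps)
  then show "ap ((ad (opE i) ^^ nat (1 - M $$ (i, j))) (opE j)) (\<lambda>w. if w = [] then 1 else 0) = (\<lambda>w. 0)" .
qed

text \<open>
  The submodule is a module over the presented Lie algebra. This is the source of nontriviality:
  an operator that does not annihilate it certifies a nonzero element of the Lie algebra.
\<close>

lemma annihilates_lie_ideal:
  assumes M: "cartan_matrix M"
    and p: "p \<in> lie_ideal (km_generators M) (km_relators M)"
  shows "annihilates M (nonassoc_op M p)"
  using p
proof induction
  case (relator r)
  then show ?case
    by cases
      (use M in \<open>simp_all add: nonassoc_op_bracket nonassoc_op_bracket_pow nonassoc_op_diff nonassoc_op_add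
        nonassoc_op_scale scal_of_int ad_HH ad_EF ad_HE ad_HF serre_E_op serre_F_op\<close>)
next
  case (jacobi x y z)
  then show ?case
    by (simp add: nonassoc_op_bracket nonassoc_op_add) (simp add: ad_def algebra_simps)
qed (simp_all add: nonassoc_op_bracket nonassoc_op_add nonassoc_op_scale annihilates_add
      annihilates_mult_left annihilates_ad preserves_nonassoc_op)

section \<open>The grading by height\<close>

primrec height :: "chevalley_generator bracket_word \<Rightarrow> int" where
  "height (Letter g) = (case g of E i \<Rightarrow> 1 | F i \<Rightarrow> - 1 | H i \<Rightarrow> 0)"
| "height (Bracket u v) = height u + height v"

definition homogeneous :: "int \<Rightarrow> (nat list \<Rightarrow> complex) \<Rightarrow> bool" where
  "homogeneous n x \<longleftrightarrow> (\<forall>v. x v \<noteq> 0 \<longrightarrow> int (length v) = n)"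

lemma homogeneous_lower: "homogeneous n x \<Longrightarrow> homogeneous (n + 1) (ap (opF M j) x)"
  unfolding homogeneous_def opF.rep_eq
proof (intro allI impI)
  fix w assume "\<forall>v. x v \<noteq> 0 \<longrightarrow> int (length v) = n" "lower M j w x \<noteq> 0"
  then show "int (length w) = n + 1"
  proof (induction w arbitrary: x n)
    case (Cons i w)
    show ?case
    proof (cases "lower M j w (\<lambda>v. x (i # v)) = 0")
      case True
      then show ?thesis using Cons.prems by (auto split: if_splits)
    next
      case False
      have "int (length w) = (n - 1) + 1"
        by (rule Cons.IH[OF _ False]) (use Cons.prems(1) in force)
      then show ?thesis by simp
    qed
  qed simp
qed

lemma homogeneous_word_op:
  "homogeneous n x \<Longrightarrow> homogeneous (n - height w) (ap (word_op M w) x)"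
proof (induction w arbitrary: n x)
  case (Letter g)
  show ?case
  proof (cases g)
    case (E i)
    then show ?thesis using Letter by (force simp: homogeneous_def op_simps)
  next
    case (F i)
    then show ?thesis using homogeneous_lower[OF Letter] by simp
  next
    case (H i)
    then show ?thesis using Letter by (simp add: homogeneous_def op_simps)
  qed
next
  case (Bracket u v)
  have "homogeneous (n - height u - height v) (ap (word_op M v) (ap (word_op M u) x))"
    "homogeneous (n - height v - height u) (ap (word_op M u) (ap (word_op M v) x))"
    by (intro Bracket)+
  then show ?case
    by (force simp: homogeneous_def ad_def ap_simps algebra_simps)
qed

text \<open>
  The submodule is graded by word length, being spanned by homogeneous vectors. The induction is
  over the generation of a vector, the operator absorbing one lowering operator at a time.
\<close>

lemma annihilatesI_homogeneous:
  assumes "\<And>n x. x \<in> verma M \<Longrightarrow> homogeneous n x \<Longrightarrow> ap A x = (\<lambda>w. 0)"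
  shows "annihilates M A"
  unfolding annihilates_def
proof
  fix x assume "x \<in> verma M"
  then show "ap A x = (\<lambda>w. 0)"
    using assms
  proof (induction arbitrary: A)
    case vacuum
    have "homogeneous 0 (\<lambda>w. if w = [] then 1 else 0)" by (simp add: homogeneous_def)
    then show ?case using vacuum verma.vacuum by blast
  next
    case (lower x i)
    have "ap (A * opF M i) x = (\<lambda>w. 0)"
    proof (rule lower.IH)
      fix n y assume y: "y \<in> verma M" "homogeneous n y"
      show "ap (A * opF M i) y = (\<lambda>w. 0)"
        using lower.prems[OF verma.lower[OF y(1)] homogeneous_lower[OF y(2)]] by (simp add: ap_simps)
    qed
    then show ?case by (simp add: ap_simps)
  next
    case (add x y)
    then show ?case by (simp add: ap_add)
  next
    case (cmult x c)
    then show ?case by (simp add: ap_cmult)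
  qed
qed

text \<open>
  A finite spanning set involves bracket words of bounded height only. A relation expressing a
  bracket word of larger height through it splits into homogeneous components when applied to a
  homogeneous vector, and the component of that word stands alone.
\<close>

lemma finite_dim_height_bound:
  assumes M: "cartan_matrix M"
    and fin: "presented_lie_algebra_finite_dim (km_generators M) (km_relators M)"
  obtains K where "\<And>w. set_bracket_word w \<subseteq> km_generators M \<Longrightarrow> \<bar>height w\<bar> > K \<Longrightarrow>
    annihilates M (word_op M w)"
proof -
  obtain S where S: "finite S" and spans: "\<And>x. x \<in> free_nonassoc (km_generators M) \<Longrightarrow>
      \<exists>c. x - (\<Sum>s\<in>S. scale (c s) s) \<in> lie_ideal (km_generators M) (km_relators M)"
    using fin unfolding presented_lie_algebra_finite_dim_def by metis
  define W where "W = (\<Union>s\<in>S. Poly_Mapping.keys s)"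
  have "finite W" using S by (simp add: W_def)
  define K where "K = Max (insert 0 ((\<lambda>u. \<bar>height u\<bar>) ` W))"
  have K: "\<bar>height u\<bar> \<le> K" if "u \<in> W" for u
    unfolding K_def using that \<open>finite W\<close> by (intro Max_ge) auto
  have "annihilates M (word_op M w)"
    if w: "set_bracket_word w \<subseteq> km_generators M" "\<bar>height w\<bar> > K" for w
  proof (rule annihilatesI_homogeneous)
    fix n x assume x: "x \<in> verma M" "homogeneous n x"
    have "Poly_Mapping.single w (1::complex) \<in> free_nonassoc (km_generators M)"
      using w by (simp add: free_nonassoc_def)
    from spans[OF this] obtain c where
      "Poly_Mapping.single w 1 - (\<Sum>s\<in>S. scale (c s) s) \<in> lie_ideal (km_generators M) (km_relators M)" ..
    from annihilates_lie_ideal[OF M this]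
    have "annihilates M (word_op M w - (\<Sum>s\<in>S. scal (c s) * nonassoc_op M s))"
      by (simp add: nonassoc_op_diff nonassoc_op_single nonassoc_op_sum nonassoc_op_scale)
    then have eq: "ap (word_op M w) x v = (\<Sum>s\<in>S. c s * ap (nonassoc_op M s) x v)" for v
      using x(1) by (simp add: annihilates_def ap_simps ap_sum fun_eq_iff)
    show "ap (word_op M w) x = (\<lambda>v. 0)"
    proof
      fix v
      show "ap (word_op M w) x v = 0"
      proof (rule ccontr)
        assume nz: "ap (word_op M w) x v \<noteq> 0"
        then have lv: "int (length v) = n - height w"
          using homogeneous_word_op[OF x(2), of w M] by (simp add: homogeneous_def)
        have "ap (word_op M u) x v = 0" if "u \<in> W" for u
        proof (rule ccontr)
          assume "ap (word_op M u) x v \<noteq> 0"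
          then have "int (length v) = n - height u"
            using homogeneous_word_op[OF x(2), of u M] by (simp add: homogeneous_def)
          then show False using lv K[OF that] w(2) by simp
        qed
        then have "ap (nonassoc_op M s) x v = 0" if "s \<in> S" for s
          using that unfolding nonassoc_op_def ap_sum
          by (intro sum.neutral) (auto simp: ap_simps W_def)
        then show False using nz by (simp add: eq)
      qed
    qed
  qed
  then show thesis by (rule that)
qed

section \<open>A criterion for infinite dimension\<close>

primrec weight :: "int mat \<Rightarrow> nat \<Rightarrow> chevalley_generator bracket_word \<Rightarrow> int" where
  "weight M i (Letter g) = (case g of E j \<Rightarrow> M $$ (i, j) | F j \<Rightarrow> - M $$ (i, j) | H j \<Rightarrow> 0)"
| "weight M i (Bracket u v) = weight M i u + weight M i v"

lemma ad_opH_word_op: "ad (opH M i) (word_op M w) = of_int (weight M i w) * word_op M w"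
proof (induction w)
  case (Letter g)
  then show ?case by (cases g) (simp_all add: ad_HH ad_HE ad_HF)
next
  case (Bracket u v)
  then show ?case by (simp add: ad_ad[of "opH M i"] distrib_right)
qed

primrec letter_count :: "'a \<Rightarrow> 'a bracket_word \<Rightarrow> int" where
  "letter_count a (Letter b) = (if a = b then 1 else 0)"
| "letter_count a (Bracket u v) = letter_count a u + letter_count a v"

lemma letter_count_nonneg: "letter_count a w \<ge> 0"
  by (induction w) simp_all

lemma height_E_word:
  "set_bracket_word w \<subseteq> E ` {..<n} \<Longrightarrow> height w = (\<Sum>j<n. letter_count (E j) w)"
proof (induction w)
  case (Letter g)
  then obtain k where "g = E k" "k < n" by auto
  then show ?case by simp
qed (simp add: sum.distrib)

lemma height_E_word_pos: "set_bracket_word w \<subseteq> E ` {..<n} \<Longrightarrow> height w > 0"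
  by (induction w) (auto simp: add_pos_pos)

lemma weight_E_word:
  "set_bracket_word w \<subseteq> E ` {..<n} \<Longrightarrow>
    weight M i w = (\<Sum>j<n. M $$ (i, j) * letter_count (E j) w)"
proof (induction w)
  case (Letter g)
  then obtain k where "g = E k" "k < n" by auto
  then show ?case by (simp add: if_distrib[where f = "\<lambda>x. c * x" for c] cong: if_cong)
qed (simp add: sum.distrib distrib_left)

text \<open>
  Here the highest weight enters: \<open>e\<^sub>i f\<^sub>i v = h\<^sub>i v = v\<close> is not zero.
\<close>

lemma opE_not_annihilates: "\<not> annihilates M (opE i)"
proof
  let ?vac = "\<lambda>w::nat list. if w = [] then 1 else (0::complex)"
  assume "annihilates M (opE i)"
  then have "ap (opE i) (ap (opF M i) ?vac) = (\<lambda>w. 0)"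
    by (simp add: annihilates_def verma.vacuum verma.lower)
  from fun_cong[OF this, of "[]"] show False
    by (simp add: op_simps)
qed

text \<open>
  If the algebra had finite dimension, there would be a nonvanishing bracket word in the \<open>e\<^sub>i\<close> of
  maximal height, of weight \<open>p = \<Sum> p\<^sub>j \<alpha>\<^sub>j\<close> say. Maximality makes it a highest weight vector for
  each of the standard \<open>sl\<^sub>2\<close>-subalgebras, and the height bound makes it a vector on which each
  \<open>ad f\<^sub>i\<close> is nilpotent. Hence \<open>p(h\<^sub>i) \<ge> 0\<close> for all \<open>i\<close>, that is \<open>M p \<ge> 0\<close>. Matrices of finite type
  admit such \<open>p\<close>, the highest root; matrices of indefinite type do not.
\<close>

theorem kac_moody_infinite_dimI:
  assumes M: "cartan_matrix M" and n: "dim_row M > 0"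
    and no: "\<And>p. (\<And>j. p j \<ge> 0) \<Longrightarrow>
      (\<And>i. i < dim_row M \<Longrightarrow> (\<Sum>j<dim_row M. M $$ (i, j) * p j) \<ge> 0) \<Longrightarrow>
      (\<Sum>j<dim_row M. p j) = 0"
  shows "kac_moody_infinite_dim M"
  unfolding kac_moody_infinite_dim_def
proof
  let ?n = "dim_row M"
  assume "presented_lie_algebra_finite_dim (km_generators M) (km_relators M)"
  then obtain K where K: "\<And>w. set_bracket_word w \<subseteq> km_generators M \<Longrightarrow> \<bar>height w\<bar> > K \<Longrightarrow>
      annihilates M (word_op M w)"
    using finite_dim_height_bound[OF M] by blast
  define P where "P w \<longleftrightarrow> set_bracket_word w \<subseteq> E ` {..<?n} \<and> \<not> annihilates M (word_op M w)" for w
  have P0: "P (Letter (E 0))"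
    using n by (simp add: P_def opE_not_annihilates)
  have bound: "nat (height w) \<le> nat K" if "P w" for w
  proof -
    have "set_bracket_word w \<subseteq> km_generators M"
      using that by (auto simp: P_def km_generators_def)
    then have "\<not> \<bar>height w\<bar> > K" using K[of w] that unfolding P_def by blast
    then show ?thesis by simp
  qed
  obtain w where w: "P w" and max: "\<And>v. P v \<Longrightarrow> nat (height v) \<le> nat (height w)"
    using ex_has_greatest_nat[of P "Letter (E 0)" "\<lambda>w. nat (height w)" "Suc (nat K)", OF P0] bound
    by (metis less_Suc_eq_le)
  have wE: "set_bracket_word w \<subseteq> E ` {..<?n}" and w0: "\<not> annihilates M (word_op M w)"
    using w by (simp_all add: P_def)
  have "weight M i w \<ge> 0" if i: "i < ?n" for i
  proof -
    have top: "annihilates M (ad (opE i) (word_op M w))"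
    proof (rule ccontr)
      assume "\<not> ?thesis"
      then have "P (Bracket (Letter (E i)) w)"
        using wE i by (simp add: P_def)
      from max[OF this] show False
        using height_E_word_pos[OF wE] by simp
    qed
    let ?v = "\<lambda>k. (Bracket (Letter (F i)) ^^ k) w"
    have v: "word_op M (?v k) = (ad (opF M i) ^^ k) (word_op M w)" "height (?v k) = height w - int k"
      "set_bracket_word (?v k) \<subseteq> km_generators M" for k
      using wE i by (induction k) (auto simp: km_generators_def)
    have "annihilates M (word_op M (?v (nat (height w + \<bar>K\<bar> + 1))))"
      using v(2)[of "nat (height w + \<bar>K\<bar> + 1)"] height_E_word_pos[OF wE] by (intro K v(3)) simp
    then have ex: "\<exists>k. annihilates M ((ad (opF M i) ^^ k) (word_op M w))"
      unfolding v by blast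
    \<comment> \<open>With the least vanishing power the coefficient in \<open>sl2_raise\<close> has to vanish.\<close>
    define k where "k = (LEAST k. annihilates M ((ad (opF M i) ^^ k) (word_op M w)))"
    have k: "annihilates M ((ad (opF M i) ^^ k) (word_op M w))"
      unfolding k_def using ex by (rule LeastI_ex)
    have "k \<noteq> 0"
      using k w0 by (intro notI) simp
    then have k1: "\<not> annihilates M ((ad (opF M i) ^^ (k - 1)) (word_op M w))"
      using not_less_Least[of "k - 1" "\<lambda>k. annihilates M ((ad (opF M i) ^^ k) (word_op M w))"]
      by (simp add: k_def)
    let ?c = "int k * (weight M i w - int k + 1)"
    have a: "M $$ (i, i) = 2"
      using M i by (simp add: cartan_matrix_def)
    have "ad (opE i) ((ad (opF M i) ^^ k) (word_op M w)) =
        of_int ?c * (ad (opF M i) ^^ (k - 1)) (word_op M w) +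
        (ad (opF M i) ^^ k) (ad (opE i) (word_op M w))"
      by (rule sl2_raise[where h = "opH M i"]) (simp_all add: ad_EF ad_HF a ad_opH_word_op)
    then have "of_int ?c * (ad (opF M i) ^^ (k - 1)) (word_op M w) =
        ad (opE i) ((ad (opF M i) ^^ k) (word_op M w)) -
        (ad (opF M i) ^^ k) (ad (opE i) (word_op M w))"
      by (simp only: add_diff_cancel_right')
    then have "annihilates M (of_int ?c * (ad (opF M i) ^^ (k - 1)) (word_op M w))"
      by (simp only:) (intro annihilates_diff annihilates_ad annihilates_ad_pow k top
        preserves_opE preserves_opF)
    then have "?c = 0"
      using k1
      by (auto simp only: annihilates_def ap_simps ap_of_int fun_eq_iff mult_eq_0_iff of_int_eq_0_iff)
    then show ?thesis using \<open>k \<noteq> 0\<close> by simp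
  qed
  then have "(\<Sum>j<?n. letter_count (E j) w) = 0"
    by (intro no letter_count_nonneg) (simp flip: weight_E_word[OF wE])
  then show False
    using height_E_word[OF wE] height_E_word_pos[OF wE] by simp
qed

section \<open>Words and their classes\<close>

text \<open>
  The defining relators as words, so that relators can be followed through coset tables.
\<close>

definition weyl_relator :: "int mat \<Rightarrow> nat list \<Rightarrow> bool" where
  "weyl_relator M w \<longleftrightarrow> (\<exists>i<dim_row M. w = [i, i]) \<or>
     (\<exists>i<dim_row M. \<exists>j<dim_row M. i \<noteq> j \<and>
        (\<exists>m. coxeter_exponent M i j = enat m \<and> w = concat (replicate m [i, j])))"

lemma foldr_weyl_mult:
  "u \<in> lists {..<dim_row M} \<Longrightarrow>
    foldr (mult (weyl_group M)) (map (\<lambda>i. weyl_class M [i]) u) (one (weyl_group M)) = weyl_class M u"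
proof (induction u)
  case (Cons i u)
  then show ?case using weyl_mult_class[of "[i]" M u] by simp
qed (simp add: weyl_group_def)

text \<open>
  Products of generators are classes of words, so the length is the minimal length of a word in
  the class.
\<close>

lemma weyl_length_class:
  assumes "u \<in> lists {..<dim_row M}"
  shows "weyl_length M (weyl_class M u) = (LEAST k. \<exists>v. length v = k \<and> weyl_eq M v u)"
proof -
  have "(\<exists>xs. length xs = k \<and> set xs \<subseteq> weyl_generators M \<and>
        foldr (mult (weyl_group M)) xs (one (weyl_group M)) = weyl_class M u) \<longleftrightarrow>
      (\<exists>v. length v = k \<and> weyl_eq M v u)" (is "?L \<longleftrightarrow> ?R") for k
  proof
    assume ?L
    then obtain xs where xs: "length xs = k" "set xs \<subseteq> weyl_generators M"
      "foldr (mult (weyl_group M)) xs (one (weyl_group M)) = weyl_class M u" by blast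
    have "xs \<in> lists ((\<lambda>i. weyl_class M [i]) ` {..<dim_row M})"
      using xs(2) by (auto simp: weyl_generators_def)
    then obtain v where v: "v \<in> lists {..<dim_row M}" "xs = map (\<lambda>i. weyl_class M [i]) v"
      unfolding lists_image by blast
    then have "weyl_eq M v u"
      using xs(3) by (simp add: foldr_weyl_mult weyl_class_eq_iff)
    then show ?R using v xs(1) by auto
  next
    assume ?R
    then obtain v where v: "length v = k" "weyl_eq M v u" by blast
    then have "v \<in> lists {..<dim_row M}" using weyl_eq_lists by blast
    then show ?L
      using v by (intro exI[of _ "map (\<lambda>i. weyl_class M [i]) v"])
        (auto simp: foldr_weyl_mult weyl_generators_def weyl_class_eqI)
  qed
  then show ?thesis by (simp add: weyl_length_def)
qed

section \<open>Normal forms in an amalgamated product\<close>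

text \<open>
  Normal forms alternate between two sides. With \<open>y\<close> and \<open>z\<close> counting those that begin on a given
  side, \<open>a\<close> and \<open>b\<close> counting the nontrivial coset representatives of the sides and \<open>p\<close> the
  amalgamated subgroup, the two equations determine the total.
\<close>

lemma two_sided_series:
  fixes p a b y z :: "'a::comm_ring_1"
  assumes y: "y = a * (p + z)" and z: "z = b * (p + y)"
  shows "(p + y + z) * (1 - a * b) = p * (1 + a) * (1 + b)"
proof -
  have "y * (1 - a * b) = a * (p + b * (p + y)) - a * b * y"
    unfolding z[symmetric] y[symmetric] by (simp add: algebra_simps)
  then have Y: "y * (1 - a * b) = a * p * (1 + b)"
    by (simp add: algebra_simps)
  have "z * (1 - a * b) = b * (p + a * (p + z)) - a * b * z"
    unfolding y[symmetric] z[symmetric] by (simp add: algebra_simps)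
  then have Z: "z * (1 - a * b) = b * p * (1 + a)"
    by (simp add: algebra_simps)
  have "(p + y + z) * (1 - a * b) = p * (1 - a * b) + y * (1 - a * b) + z * (1 - a * b)"
    by (simp only: distrib_right)
  also have "\<dots> = p * (1 + a) * (1 + b)"
    unfolding Y Z by (simp add: algebra_simps)
  finally show ?thesis .
qed

text \<open>
  A coset table for a subgroup describes the left action of a generator \<open>s\<close> on minimal
  representatives: either \<open>s r\<close> is again the representative of a coset, or \<open>s r = r q\<close> for a
  generator \<open>q\<close> of the subgroup, and then \<open>q\<close> is passed on to the right. Running a word through
  the table, its last letter first, yields the coset reached and the word that was passed on.
\<close>

primrec run :: "(nat \<Rightarrow> nat \<Rightarrow> nat \<times> nat option) \<Rightarrow> nat list \<Rightarrow> nat \<Rightarrow> nat \<times> nat list" where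
  "run tr [] k = (k, [])"
| "run tr (s # w) k = (case run tr w k of (k1, p) \<Rightarrow>
     (case tr s k1 of (k2, None) \<Rightarrow> (k2, p) | (k2, Some q) \<Rightarrow> (k2, q # p)))"

text \<open>
  The cosets, numbered from 0, of the special subgroup generated by \<open>base\<close> in the special
  subgroup generated by \<open>base\<close> and one further generator. The condition \<open>trans_relator\<close> says that
  each relator fixes every coset and passes on a trivial word; for minimal representatives the
  passed word is empty or a relator, so no further reduction is needed.
\<close>

locale coset_table =
  fixes M :: "int mat" and base :: "nat set" and outer :: nat
    and N :: nat and trans :: "nat \<Rightarrow> nat \<Rightarrow> nat \<times> nat option" and rep :: "nat \<Rightarrow> nat list"
  assumes outer_notin: "outer \<notin> base"
    and N: "1 < N"
    and trans_outer: "trans outer 0 = (1, None)"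
    and trans_base: "s \<in> base \<Longrightarrow> trans s 0 = (0, Some s)"
    and trans_pass: "k < N \<Longrightarrow> s \<in> insert outer base \<Longrightarrow> trans s k = (k', Some q) \<Longrightarrow>
      k' = k \<and> q \<in> base \<and> weyl_eq M (s # rep k) (rep k @ [q])"
    and trans_move: "k < N \<Longrightarrow> s \<in> insert outer base \<Longrightarrow> trans s k = (k', None) \<Longrightarrow>
      k' < N \<and> (s \<in> base \<longrightarrow> k \<noteq> 0 \<longrightarrow> k' \<noteq> 0) \<and> weyl_eq M (s # rep k) (rep k') \<and>
      length (rep k') \<le> Suc (length (rep k))"
    and trans_relator: "weyl_relator M w \<Longrightarrow> set w \<subseteq> insert outer base \<Longrightarrow> k < N \<Longrightarrow>
      \<exists>p. run trans w k = (k, p) \<and> (p = [] \<or> weyl_relator M p \<and> set p \<subseteq> base)"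
    and rep_0: "rep 0 = []"
    and rep_run: "k < N \<Longrightarrow> set (rep k) \<subseteq> insert outer base \<and> run trans (rep k) 0 = (k, [])"

text \<open>
  The regular representation of the amalgamated subgroup itself.
\<close>

locale base_table =
  fixes M :: "int mat" and base :: "nat set"
    and N0 :: nat and step :: "nat \<Rightarrow> nat \<Rightarrow> nat" and rep0 :: "nat \<Rightarrow> nat list"
  assumes N0: "0 < N0"
    and step: "c < N0 \<Longrightarrow> s \<in> base \<Longrightarrow> step s c < N0 \<and>
      weyl_eq M (s # rep0 c) (rep0 (step s c)) \<and> length (rep0 (step s c)) \<le> Suc (length (rep0 c))"
    and step_relator: "weyl_relator M w \<Longrightarrow> set w \<subseteq> base \<Longrightarrow> c < N0 \<Longrightarrow> foldr step w c = c"
    and rep0_0: "rep0 0 = []"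
    and rep0_run: "c < N0 \<Longrightarrow> set (rep0 c) \<subseteq> base \<and> foldr step (rep0 c) 0 = c"

text \<open>
  Normal forms \<open>r\<^sub>1 r\<^sub>2 \<dots> r\<^sub>n c\<close>: the \<open>r\<^sub>i\<close> are nontrivial coset representatives, alternately from
  the two factors (the sides \<open>True\<close> and \<open>False\<close>), and \<open>c\<close> lies in the amalgamated subgroup.
\<close>

datatype nf = Base nat | Node bool nat nf

primrec head :: "nf \<Rightarrow> bool option" where
  "head (Base c) = None"
| "head (Node d k x) = Some d"

definition join :: "bool \<Rightarrow> nat \<Rightarrow> nf \<Rightarrow> nf" where
  "join d k x = (if k = 0 then x else Node d k x)"

text \<open>
  Two generators whose product has infinite order, one on each side; all other relators belong to
  one of the two sides, so the Coxeter group is the amalgamated product of the special subgroups.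
\<close>

locale coxeter_amalgam = base_table M base N0 step rep0
  for M :: "int mat" and base :: "nat set" and N0 step rep0 +
  fixes outer :: "bool \<Rightarrow> nat" and N :: nat
    and trans :: "bool \<Rightarrow> nat \<Rightarrow> nat \<Rightarrow> nat \<times> nat option" and rep :: "bool \<Rightarrow> nat \<Rightarrow> nat list"
  assumes table: "coset_table M base (outer d) N (trans d) (rep d)"
    and generators: "{..<dim_row M} = base \<union> range outer"
    and free: "coxeter_exponent M (outer d) (outer (\<not> d)) = \<infinity>"
    and outer_distinct: "outer True \<noteq> outer False"
begin

lemmas outer_notin = coset_table.outer_notin[OF table]
lemmas N = coset_table.N[OF table]
lemmas trans_outer = coset_table.trans_outer[OF table]
lemmas trans_base = coset_table.trans_base[OF table]
lemmas trans_pass = coset_table.trans_pass[OF table]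
lemmas trans_move = coset_table.trans_move[OF table]
lemmas trans_relator = coset_table.trans_relator[OF table]
lemmas rep_0 = coset_table.rep_0[OF table]
lemmas rep_run = coset_table.rep_run[OF table]
lemmas outer = outer_notin outer_distinct

abbreviation gens :: "bool \<Rightarrow> nat set" where
  "gens d \<equiv> insert (outer d) base"

text \<open>
  A generator acts on the first representative and, if it is passed on, on the rest. This defines
  the left regular representation on normal forms before it is known that they represent the
  group faithfully.
\<close>

fun act :: "nat \<Rightarrow> nf \<Rightarrow> nf" where
  "act s (Base c) = (if s \<in> base then Base (step s c) else Node (s = outer True) 1 (Base c))"
| "act s (Node d k x) =
     (if s \<in> gens d then
        (case trans d s k of (k', None) \<Rightarrow> join d k' x | (k', Some q) \<Rightarrow> Node d k' (act q x))
      else Node (\<not> d) 1 (Node d k x))"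

primrec valid :: "nf \<Rightarrow> bool" where
  "valid (Base c) \<longleftrightarrow> c < N0"
| "valid (Node d k x) \<longleftrightarrow> 0 < k \<and> k < N \<and> valid x \<and> head x \<noteq> Some d"

primrec word :: "nf \<Rightarrow> nat list" where
  "word (Base c) = rep0 c"
| "word (Node d k x) = rep d k @ word x"

lemma base_less: "s \<in> base \<Longrightarrow> s < dim_row M"
  and outer_less: "outer d < dim_row M"
  using generators by auto

lemma gens_cases:
  assumes "s < dim_row M"
  obtains "s \<in> base" | d where "s = outer d"
  using assms generators by auto

lemma outer_eq_iff [simp]: "outer d = outer e \<longleftrightarrow> d = e"
  using outer_distinct by (cases d; cases e) auto

text \<open>
  A normal form that does not begin on side \<open>d\<close> is treated as beginning with the trivial coset of
  that side. The action of the factor \<open>d\<close> is then given by its coset table throughout, which makes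
  the set of normal forms a representation induced from the amalgamated subgroup.
\<close>

lemma act_join:
  assumes "head x \<noteq> Some d" "s \<in> gens d" "k < N"
  shows "act s (join d k x) =
    (case trans d s k of (k', None) \<Rightarrow> join d k' x | (k', Some q) \<Rightarrow> join d k' (act q x))"
proof (cases "k = 0")
  case False
  have "trans d s k = (0, Some q) \<Longrightarrow> False" for q
    using assms False trans_pass by blast
  then show ?thesis
    using assms False by (auto simp: join_def split: prod.splits option.splits)
next
  case True
  show ?thesis
  proof (cases "s \<in> base")
    case True
    then show ?thesis using \<open>k = 0\<close> by (simp add: trans_base join_def)
  next
    case False
    then have s: "s = outer d" using assms(2) by simp
    have "act (outer d) x = Node d 1 x"
    proof (cases x)
      case (Node e k' y)
      then have "e = (\<not> d)" using assms(1) by auto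
      then show ?thesis using Node outer_notin by simp
    qed (simp add: outer_notin)
    then show ?thesis using \<open>k = 0\<close> s by (simp add: trans_outer join_def)
  qed
qed

lemma valid_join: "k < N \<Longrightarrow> valid x \<Longrightarrow> head x \<noteq> Some d \<Longrightarrow> valid (join d k x)"
  by (simp add: join_def)

lemma valid_cases:
  assumes "valid x"
  obtains k y where "x = join d k y" "k < N" "valid y" "head y \<noteq> Some d"
proof (cases "head x = Some d")
  case True
  then obtain k y where "x = Node d k y" by (cases x) auto
  then show thesis using assms by (intro that[of k y]) (auto simp: join_def)
next
  case False
  then show thesis using assms N by (intro that[of 0 x]) (auto simp: join_def)
qed

lemma act_base: "valid x \<Longrightarrow> s \<in> base \<Longrightarrow> valid (act s x) \<and> head (act s x) = head x"
proof (induction x arbitrary: s)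
  case (Base c)
  then show ?case by (simp add: step)
next
  case (Node d k x)
  then have k: "k < N" "s \<in> gens d" "k \<noteq> 0" by auto
  show ?case
  proof (cases "trans d s k")
    case (Pair k' o')
    show ?thesis
    proof (cases o')
      case None
      then show ?thesis using Pair trans_move[OF k(1,2)] Node.prems k by (auto simp: join_def)
    next
      case (Some q)
      then show ?thesis using Pair trans_pass[OF k(1,2)] Node k by auto
    qed
  qed
qed

lemma valid_act:
  assumes "valid x" "s < dim_row M"
  shows "valid (act s x)"
  using assms(2)
proof (cases rule: gens_cases)
  case 1
  then show ?thesis using act_base assms by blast
next
  case (2 d)
  obtain k y where x: "x = join d k y" and y: "k < N" "valid y" "head y \<noteq> Some d"
    using valid_cases[OF assms(1)] by metis
  have s: "s \<in> gens d" using 2 by simp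
  show ?thesis
  proof (cases "trans d s k")
    case (Pair k' o')
    show ?thesis
    proof (cases o')
      case None
      then show ?thesis
        using Pair trans_move[OF y(1) s] y by (auto simp: x act_join[OF y(3) s y(1)] valid_join)
    next
      case (Some q)
      then show ?thesis
        using Pair trans_pass[OF y(1) s] y act_base[of y q]
        by (auto simp: x act_join[OF y(3) s y(1)] valid_join)
    qed
  qed
qed

lemma valid_foldr_act: "set w \<subseteq> {..<dim_row M} \<Longrightarrow> valid x \<Longrightarrow> valid (foldr act w x)"
  by (induction w) (auto simp: valid_act)

lemma foldr_act_base:
  "set w \<subseteq> base \<Longrightarrow> valid x \<Longrightarrow> valid (foldr act w x) \<and> head (foldr act w x) = head x"
  by (induction w) (auto simp: act_base)

lemma foldr_act_join:
  assumes "set w \<subseteq> gens d" "k < N" "valid x" "head x \<noteq> Some d"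
  shows "fst (run (trans d) w k) < N \<and> set (snd (run (trans d) w k)) \<subseteq> base \<and>
    foldr act w (join d k x) =
      join d (fst (run (trans d) w k)) (foldr act (snd (run (trans d) w k)) x)"
  using assms(1)
proof (induction w)
  case (Cons s w)
  obtain k1 p where r: "run (trans d) w k = (k1, p)" by fastforce
  have k1: "k1 < N" "set p \<subseteq> base" and eq: "foldr act w (join d k x) = join d k1 (foldr act p x)"
    and s: "s \<in> gens d"
    using Cons r by auto
  have h: "head (foldr act p x) \<noteq> Some d"
    using foldr_act_base[OF k1(2) assms(3)] assms(4) by simp
  obtain k2 o2 where t: "trans d s k1 = (k2, o2)" by fastforce
  show ?case
  proof (cases o2)
    case None
    then show ?thesis
      using trans_move[OF k1(1) s] t k1 by (auto simp: r eq act_join[OF h s k1(1)])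
  next
    case (Some q)
    then show ?thesis
      using trans_pass[OF k1(1) s] t k1 by (auto simp: r eq act_join[OF h s k1(1)])
  qed
qed (use assms in simp)

text \<open>
  The relators of the amalgamated subgroup come first: the words passed on by any relator are
  again of this kind, and act on a shorter normal form.
\<close>

lemma base_relator_act:
  "weyl_relator M w \<Longrightarrow> set w \<subseteq> base \<Longrightarrow> valid x \<Longrightarrow> foldr act w x = x"
proof (induction x arbitrary: w)
  case (Base c)
  have "foldr act w (Base c) = Base (foldr step w c)"
    using Base.prems(2) by (induction w) auto
  then show ?case using Base step_relator by simp
next
  case (Node d k x)
  have v: "k \<noteq> 0" "k < N" "valid x" "head x \<noteq> Some d" using Node.prems by auto
  have w: "set w \<subseteq> gens d" using Node.prems by auto
  obtain p where p: "run (trans d) w k = (k, p)" "p = [] \<or> weyl_relator M p \<and> set p \<subseteq> base"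
    using trans_relator[OF Node.prems(1) w v(2)] by blast
  have "foldr act p x = x" using p(2) Node.IH v(3) by auto
  then have "foldr act w (join d k x) = join d k x"
    using foldr_act_join[OF w v(2-)] by (simp add: p(1))
  then show ?case using v(1) by (simp add: join_def)
qed

lemma relator_gens:
  assumes "weyl_relator M w"
  obtains d where "set w \<subseteq> gens d"
proof -
  have one: "\<exists>d. i \<in> gens d" if "i < dim_row M" for i
    using that by (cases rule: gens_cases) auto
  have two: "\<exists>d. i \<in> gens d \<and> j \<in> gens d"
    if i: "i < dim_row M" and j: "j < dim_row M" and m: "coxeter_exponent M i j = enat m" for i j m
    using i
  proof (cases rule: gens_cases)
    case 1
    then show ?thesis using one[OF j] by blast
  next
    case i: (2 d)
    from j show ?thesis
    proof (cases rule: gens_cases)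
      case (2 e)
      then have "e = d" using i m free[of d] by (cases e; cases d) auto
      then show ?thesis using i 2 by blast
    qed (use i in blast)
  qed
  consider i where "i < dim_row M" "w = [i, i]"
    | i j m where "i < dim_row M" "j < dim_row M" "coxeter_exponent M i j = enat m"
        "w = concat (replicate m [i, j])"
    using assms unfolding weyl_relator_def by blast
  then show thesis
  proof cases
    case 1
    then obtain d where "i \<in> gens d" using one by blast
    with 1 show thesis by (intro that[of d]) simp
  next
    case (2 i j m)
    then obtain d where "i \<in> gens d" "j \<in> gens d" using two by blast
    moreover have "set w \<subseteq> {i, j}" unfolding 2(4) by auto
    ultimately show thesis by (intro that[of d]) blast
  qed
qed

lemma relator_act:
  assumes "weyl_relator M w" "valid x"
  shows "foldr act w x = x"
proof -
  obtain d where w: "set w \<subseteq> gens d" using relator_gens[OF assms(1)] .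
  obtain k y where x: "x = join d k y" and y: "k < N" "valid y" "head y \<noteq> Some d"
    using valid_cases[OF assms(2)] by metis
  obtain p where p: "run (trans d) w k = (k, p)" "p = [] \<or> weyl_relator M p \<and> set p \<subseteq> base"
    using trans_relator[OF assms(1) w y(1)] by blast
  have "foldr act p y = y" using p(2) base_relator_act y(2) by auto
  then show ?thesis
    using foldr_act_join[OF w y] by (simp add: p(1) x)
qed

text \<open>
  The group acts on normal forms, so equal elements have the same normal form.
\<close>

lemma weyl_eq_act:
  "weyl_eq M u v \<Longrightarrow> valid x \<Longrightarrow> foldr act u x = foldr act v x"
proof (induction arbitrary: x rule: weyl_eq.induct)
  case (square i)
  then have "weyl_relator M [i, i]" by (auto simp: weyl_relator_def)
  from relator_act[OF this square(2)] show ?case by simp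
next
  case (braid i j m)
  then have "weyl_relator M (concat (replicate m [i, j]))" by (auto simp: weyl_relator_def)
  from relator_act[OF this braid.prems] show ?case by simp
next
  case (append u u' v v')
  have "valid (foldr act v' x)"
    using weyl_eq_lists[OF append.hyps(2)] append.prems by (intro valid_foldr_act) auto
  then show ?case using append by simp
qed simp_all

lemma word_lists: "valid x \<Longrightarrow> word x \<in> lists {..<dim_row M}"
proof (induction x)
  case (Base c)
  then show ?case using rep0_run[of c] base_less by (auto simp: in_lists_conv_set)
next
  case (Node d k x)
  then show ?case using rep_run[of k d] base_less outer_less by (auto simp: in_lists_conv_set)
qed

lemma rep_lists: "k < N \<Longrightarrow> rep d k \<in> lists {..<dim_row M}"
  using rep_run[of k d] base_less outer_less by (auto simp: in_lists_conv_set)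

text \<open>
  The action on normal forms agrees with multiplication in the group and raises the length by at
  most one; the latter makes the words of normal forms reduced.
\<close>

lemma word_act:
  "valid x \<Longrightarrow> s < dim_row M \<Longrightarrow>
    weyl_eq M (s # word x) (word (act s x)) \<and> length (word (act s x)) \<le> Suc (length (word x))"
proof (induction x arbitrary: s)
  case (Base c)
  from Base(2) show ?case
  proof (cases rule: gens_cases)
    case (2 d)
    have "weyl_eq M ((outer d # rep d 0) @ word (Base c)) (rep d 1 @ word (Base c))"
      using trans_move[of 0 "outer d" d] trans_outer[of d] N word_lists[OF Base(1)]
      by (intro weyl_eq.append weyl_eq.refl) auto
    moreover have "length (rep d 1) \<le> 1"
      using trans_move[of 0 "outer d" d] trans_outer[of d] N by (simp add: rep_0)
    ultimately show ?thesis using 2 by (simp add: outer rep_0)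
  qed (use Base step in simp)
next
  case (Node d k x)
  have v: "k < N" "valid x" "head x \<noteq> Some d" "k \<noteq> 0" using Node.prems by auto
  note x = weyl_eq.refl[OF word_lists[OF v(2)]]
  show ?case
  proof (cases "s \<in> gens d")
    case s: True
    obtain k1 o1 where t: "trans d s k = (k1, o1)" by fastforce
    show ?thesis
    proof (cases o1)
      case None
      note m = trans_move[OF v(1) s t[unfolded None]]
      have w: "word (join d k1 x) = rep d k1 @ word x"
        by (simp add: join_def rep_0)
      have "weyl_eq M ((s # rep d k) @ word x) (rep d k1 @ word x)"
        using m x by (intro weyl_eq.append) auto
      then show ?thesis using s t None m by (simp add: w)
    next
      case (Some q)
      note m = trans_pass[OF v(1) s t[unfolded Some]]
      have IH: "weyl_eq M (q # word x) (word (act q x)) \<and> length (word (act q x)) \<le> Suc (length (word x))"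
        using m base_less by (intro Node.IH v) auto
      have "weyl_eq M ((s # rep d k) @ word x) ((rep d k @ [q]) @ word x)"
        using m x by (intro weyl_eq.append) auto
      moreover have "weyl_eq M (rep d k @ (q # word x)) (rep d k @ word (act q x))"
        using IH rep_lists[OF v(1)] by (intro weyl_eq.append weyl_eq.refl) auto
      ultimately have "weyl_eq M (s # rep d k @ word x) (rep d k @ word (act q x))"
        by (auto intro: weyl_eq.trans)
      then show ?thesis using s t Some m IH by simp
    qed
  next
    case False
    from Node.prems(2) have s: "s = outer (\<not> d)"
    proof (cases rule: gens_cases)
      case (2 e)
      with False have "e = (\<not> d)" by (cases d; cases e) auto
      with 2 show ?thesis by simp
    qed (use False in simp)
    have "weyl_eq M ((outer (\<not> d) # rep (\<not> d) 0) @ word (Node d k x)) (rep (\<not> d) 1 @ word (Node d k x))"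
      using trans_move[of 0 "outer (\<not> d)" "\<not> d"] trans_outer[of "\<not> d"] N word_lists[OF Node.prems(1)]
      by (intro weyl_eq.append weyl_eq.refl) auto
    moreover have "length (rep (\<not> d) 1) \<le> 1"
      using trans_move[of 0 "outer (\<not> d)" "\<not> d"] trans_outer[of "\<not> d"] N by (simp add: rep_0)
    ultimately show ?thesis using False s by (simp add: rep_0)
  qed
qed

lemma foldr_act_word: "valid x \<Longrightarrow> foldr act (word x) (Base 0) = x"
proof (induction x)
  case (Base c)
  have "foldr act w (Base b) = Base (foldr step w b)" if "set w \<subseteq> base" for w b
    using that by (induction w) auto
  then show ?case using rep0_run Base by simp
next
  case (Node d k x)
  then have v: "k < N" "valid x" "head x \<noteq> Some d" "k \<noteq> 0" by auto
  have "foldr act (rep d k) (join d 0 x) = join d k x"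
    using foldr_act_join[of "rep d k" d 0 x] rep_run[OF v(1)] v by auto
  then show ?case using Node v by (simp add: join_def)
qed

definition normal_form :: "nat list \<Rightarrow> nf" where
  "normal_form u = foldr act u (Base 0)"

lemma normal_form:
  "u \<in> lists {..<dim_row M} \<Longrightarrow>
    valid (normal_form u) \<and> weyl_eq M u (word (normal_form u)) \<and> length (word (normal_form u)) \<le> length u"
proof (induction u)
  case Nil
  then show ?case by (simp add: normal_form_def N0 rep0_0 weyl_eq.refl)
next
  case (Cons s u)
  let ?x = "normal_form u"
  have s: "s < dim_row M" and IH: "valid ?x" "weyl_eq M u (word ?x)" "length (word ?x) \<le> length u"
    using Cons by auto
  have "weyl_eq M ([s] @ u) ([s] @ word ?x)"
    using s IH by (intro weyl_eq.append weyl_eq.refl) auto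
  then have "weyl_eq M (s # u) (word (act s ?x))"
    using word_act[OF IH(1) s] by (auto intro: weyl_eq.trans)
  then show ?case
    using word_act[OF IH(1) s] valid_act[OF IH(1) s] IH(3) by (simp add: normal_form_def)
qed

lemma normal_form_cong: "weyl_eq M u v \<Longrightarrow> normal_form u = normal_form v"
  by (simp add: normal_form_def weyl_eq_act N0)

lemma normal_form_word: "valid x \<Longrightarrow> normal_form (word x) = x"
  by (simp add: normal_form_def foldr_act_word)

lemma weyl_length_normal_form:
  assumes "u \<in> lists {..<dim_row M}"
  shows "weyl_length M (weyl_class M u) = length (word (normal_form u))"
  unfolding weyl_length_class[OF assms]
proof (rule Least_equality)
  show "\<exists>v. length v = length (word (normal_form u)) \<and> weyl_eq M v u"
    using normal_form[OF assms] weyl_eq.sym by blast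
next
  fix k assume "\<exists>v. length v = k \<and> weyl_eq M v u"
  then show "length (word (normal_form u)) \<le> k"
    using normal_form normal_form_cong weyl_eq_lists by metis
qed

definition layer :: "(nf \<Rightarrow> bool) \<Rightarrow> nat \<Rightarrow> nf set" where
  "layer P k = {x. valid x \<and> P x \<and> length (word x) = k}"

lemma finite_layer: "finite (layer P k)"
proof (rule finite_imageD)
  show "inj_on word (layer P k)"
    by (intro inj_onI) (metis (mono_tags, lifting) layer_def mem_Collect_eq normal_form_word)
  have "word ` layer P k \<subseteq> {w. set w \<subseteq> {..<dim_row M} \<and> length w = k}"
    using word_lists by (auto simp: layer_def)
  then show "finite (word ` layer P k)"
    by (rule finite_subset) (simp add: finite_lists_length_eq)
qed

text \<open>
  Group elements correspond to normal forms, and the length of an element is the length of the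
  word of its normal form.
\<close>

lemma card_weyl_length:
  "card {w \<in> carrier (weyl_group M). weyl_length M w = k} = card (layer (\<lambda>x. True) k)"
proof (rule bij_betw_same_card[symmetric], rule bij_betw_imageI)
  show "inj_on (\<lambda>x. weyl_class M (word x)) (layer (\<lambda>x. True) k)"
  proof (rule inj_onI)
    fix x y assume "x \<in> layer (\<lambda>x. True) k" "y \<in> layer (\<lambda>x. True) k"
      and eq: "weyl_class M (word x) = weyl_class M (word y)"
    then have v: "valid x" "valid y" by (auto simp: layer_def)
    then have "weyl_eq M (word x) (word y)"
      using eq word_lists weyl_class_eq_iff by blast
    then show "x = y" using normal_form_cong normal_form_word v by metis
  qed
  show "(\<lambda>x. weyl_class M (word x)) ` layer (\<lambda>x. True) k =
      {w \<in> carrier (weyl_group M). weyl_length M w = k}"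
  proof (intro equalityI subsetI)
    fix w assume "w \<in> (\<lambda>x. weyl_class M (word x)) ` layer (\<lambda>x. True) k"
    then obtain x where x: "valid x" "length (word x) = k" "w = weyl_class M (word x)"
      by (auto simp: layer_def)
    then show "w \<in> {w \<in> carrier (weyl_group M). weyl_length M w = k}"
      using word_lists[OF x(1)] weyl_length_normal_form[OF word_lists[OF x(1)]]
      by (simp add: weyl_group_def normal_form_word)
  next
    fix w assume "w \<in> {w \<in> carrier (weyl_group M). weyl_length M w = k}"
    then obtain u where u: "u \<in> lists {..<dim_row M}" "w = weyl_class M u" "weyl_length M w = k"
      by (auto simp: weyl_group_def)
    then have "normal_form u \<in> layer (\<lambda>x. True) k"
      using normal_form[OF u(1)] weyl_length_normal_form[OF u(1)] by (simp add: layer_def)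
    moreover have "w = weyl_class M (word (normal_form u))"
      using normal_form[OF u(1)] u(2) weyl_class_eqI by blast
    ultimately show "w \<in> (\<lambda>x. weyl_class M (word x)) ` layer (\<lambda>x. True) k" by blast
  qed
qed

definition layer_series :: "(nf \<Rightarrow> bool) \<Rightarrow> rat fps" where
  "layer_series P = Abs_fps (\<lambda>k. of_nat (card (layer P k)))"

lemma poincare_layer: "poincare_series M = layer_series (\<lambda>x. True)"
  by (simp add: poincare_series_def layer_series_def card_weyl_length)

definition base_series :: "rat fps" where
  "base_series = (\<Sum>c<N0. fps_X ^ length (rep0 c))"

definition coset_series :: "bool \<Rightarrow> rat fps" where
  "coset_series d = (\<Sum>k\<in>{1..<N}. fps_X ^ length (rep d k))"

lemma layer_series_disjoint:
  assumes "\<And>x. \<not> (P x \<and> Q x)"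
  shows "layer_series (\<lambda>x. P x \<or> Q x) = layer_series P + layer_series Q"
proof (rule fps_ext)
  fix k
  have "layer (\<lambda>x. P x \<or> Q x) k = layer P k \<union> layer Q k" "layer P k \<inter> layer Q k = {}"
    using assms by (auto simp: layer_def)
  then show "fps_nth (layer_series (\<lambda>x. P x \<or> Q x)) k = fps_nth (layer_series P + layer_series Q) k"
    by (simp add: layer_series_def card_Un_disjoint finite_layer)
qed

lemma layer_series_None: "layer_series (\<lambda>x. head x = None) = base_series"
proof (rule fps_ext)
  fix k
  have "layer (\<lambda>x. head x = None) k = Base ` {c \<in> {..<N0}. k = length (rep0 c)}"
  proof (intro equalityI subsetI)
    fix x assume "x \<in> layer (\<lambda>x. head x = None) k"
    then show "x \<in> Base ` {c \<in> {..<N0}. k = length (rep0 c)}"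
      by (cases x) (auto simp: layer_def)
  qed (auto simp: layer_def)
  then have "card (layer (\<lambda>x. head x = None) k) = card {c \<in> {..<N0}. k = length (rep0 c)}"
    by (simp add: card_image inj_on_def)
  then show "fps_nth (layer_series (\<lambda>x. head x = None)) k = fps_nth base_series k"
    by (simp add: layer_series_def base_series_def fps_sum_nth sum.If_cases Int_def)
qed

text \<open>
  Stripping off the first representative.
\<close>

lemma layer_series_Some:
  "layer_series (\<lambda>x. head x = Some d) = coset_series d * layer_series (\<lambda>x. head x \<noteq> Some d)"
proof (rule fps_ext)
  fix n
  define S where "S k = {y. valid y \<and> head y \<noteq> Some d \<and> length (rep d k) + length (word y) = n}" for k
  have S: "S k = (if n < length (rep d k) then {}
      else layer (\<lambda>x. head x \<noteq> Some d) (n - length (rep d k)))" for k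
    by (auto simp: S_def layer_def)
  have fin: "finite (S k)" for k
    by (simp add: S finite_layer)
  have "x \<in> layer (\<lambda>x. head x = Some d) n \<longleftrightarrow> x \<in> (\<Union>k\<in>{1..<N}. Node d k ` S k)" for x
    by (cases x) (auto simp: layer_def S_def image_iff)
  then have "layer (\<lambda>x. head x = Some d) n = (\<Union>k\<in>{1..<N}. Node d k ` S k)"
    by blast
  also have "card \<dots> = (\<Sum>k\<in>{1..<N}. card (Node d k ` S k))"
    by (rule card_UN_disjoint) (simp_all add: fin, blast)
  also have "\<dots> = (\<Sum>k\<in>{1..<N}. card (S k))"
    by (simp add: card_image inj_on_def)
  finally have c: "card (layer (\<lambda>x. head x = Some d) n) = (\<Sum>k\<in>{1..<N}. card (S k))" .
  have "fps_nth (coset_series d * layer_series (\<lambda>x. head x \<noteq> Some d)) n =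
      (\<Sum>k\<in>{1..<N}. of_nat (card (S k)))"
    unfolding coset_series_def sum_distrib_right fps_sum_nth
    by (rule sum.cong[OF HOL.refl]) (simp add: fps_X_power_mult_nth layer_series_def S)
  then show "fps_nth (layer_series (\<lambda>x. head x = Some d)) n =
      fps_nth (coset_series d * layer_series (\<lambda>x. head x \<noteq> Some d)) n"
    by (simp add: layer_series_def c)
qed

text \<open>
  For the Poincare series \<open>W\<^sub>d\<close> of the factors and \<open>W\<^sub>0\<close> of the amalgamated subgroup one has
  \<open>1 + coset_series d = W\<^sub>d / W\<^sub>0\<close>, and the statement is \<open>1 / W = 1 / W\<^bsub>True\<^esub> + 1 / W\<^bsub>False\<^esub> - 1 / W\<^sub>0\<close>
  without denominators.
\<close>

theorem poincare_amalgam: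
  "poincare_series M * (1 - coset_series True * coset_series False) =
    base_series * (1 + coset_series True) * (1 + coset_series False)"
proof -
  let ?Y = "\<lambda>d. layer_series (\<lambda>x. head x = Some d)"
  have o: "(\<lambda>x. head x \<noteq> Some d) = (\<lambda>x. head x = None \<or> head x = Some (\<not> d))" for d
    by (rule ext, case_tac "head x") auto
  have Y': "layer_series (\<lambda>x. head x \<noteq> Some d) = base_series + ?Y (\<not> d)" for d
    unfolding o by (subst layer_series_disjoint) (auto simp: layer_series_None)
  have T: "?Y True = coset_series True * (base_series + ?Y False)"
    and F: "?Y False = coset_series False * (base_series + ?Y True)"
    using layer_series_Some[of True, unfolded Y'] layer_series_Some[of False, unfolded Y'] by simp_all
  have "layer_series (\<lambda>x. True) =
      ?Y True + layer_series (\<lambda>x. head x \<noteq> Some True)"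
    using layer_series_disjoint[of "\<lambda>x. head x = Some True" "\<lambda>x. head x \<noteq> Some True"] by simp
  then have P: "poincare_series M = base_series + ?Y True + ?Y False"
    unfolding Y' poincare_layer by simp
  show ?thesis unfolding P by (rule two_sided_series[OF T F])
qed

end

section \<open>Cosets in the Coxeter group of type B3\<close>

text \<open>
  Equalities between words are decided by rewriting with operators of left multiplication on the
  group; an operator equation can be applied inside a word without congruence steps.
\<close>

definition left_mult :: "int mat \<Rightarrow> nat \<Rightarrow> nat list set \<Rightarrow> nat list set" where
  "left_mult M s X = mult (weyl_group M) (weyl_class M [s]) X"

lemma left_mult_class:
  "s < dim_row M \<Longrightarrow> u \<in> lists {..<dim_row M} \<Longrightarrow>
    left_mult M s (weyl_class M u) = weyl_class M (s # u)"
  using weyl_mult_class[of "[s]" M u] by (simp add: left_mult_def)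

lemma foldr_left_mult_class:
  "w \<in> lists {..<dim_row M} \<Longrightarrow> u \<in> lists {..<dim_row M} \<Longrightarrow>
    foldr (left_mult M) w (weyl_class M u) = weyl_class M (w @ u)"
proof (induction w)
  case (Cons s w)
  then show ?case using left_mult_class[of s M "w @ u"] by auto
qed simp

lemma left_mult_closed:
  "s < dim_row M \<Longrightarrow> X \<in> carrier (weyl_group M) \<Longrightarrow> left_mult M s X \<in> carrier (weyl_group M)"
  unfolding left_mult_def
  by (rule monoid.m_closed[OF group.is_monoid[OF group_weyl_group]])
    (auto simp: weyl_group_def in_lists_conv_set)

lemma foldr_left_mult_trivial:
  assumes "weyl_eq M w []" "X \<in> carrier (weyl_group M)"
  shows "foldr (left_mult M) w X = X"
proof -
  obtain u where u: "u \<in> lists {..<dim_row M}" "X = weyl_class M u"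
    using assms(2) by (auto simp: weyl_group_def)
  have "weyl_eq M (w @ u) ([] @ u)"
    using assms(1) u by (intro weyl_eq.append weyl_eq.refl)
  then show ?thesis
    using weyl_eq_lists[OF assms(1)] u by (simp add: foldr_left_mult_class weyl_class_eqI)
qed

lemma weyl_eq_left_multI:
  assumes "u \<in> lists {..<dim_row M}" "v \<in> lists {..<dim_row M}"
    and "\<And>X. X \<in> carrier (weyl_group M) \<Longrightarrow> foldr (left_mult M) u X = foldr (left_mult M) v X"
  shows "weyl_eq M u v"
  using assms(3)[of "weyl_class M []"] assms(1,2) foldr_left_mult_class[of u M "[]"]
    foldr_left_mult_class[of v M "[]"]
  by (auto simp: weyl_group_def weyl_class_eq_iff)

lemma coxeter_exponent_commute: "coxeter_exponent M i j = coxeter_exponent M j i"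
  by (simp add: coxeter_exponent_def mult.commute)

lemma coxeter_exponent_nonzero: "coxeter_exponent M i j \<noteq> enat 0"
  by (auto simp: coxeter_exponent_def Let_def enat_0)

text \<open>
  Three generators of type \<open>B\<^sub>3\<close>, the diagram being \<open>a - b = c\<close>.
\<close>

locale b3 =
  fixes M :: "int mat" and a b c :: nat
  assumes less: "a < dim_row M" "b < dim_row M" "c < dim_row M"
    and distinct: "a \<noteq> b" "b \<noteq> c" "a \<noteq> c"
    and exponents: "coxeter_exponent M a b = enat 3" "coxeter_exponent M b c = enat 4"
      "coxeter_exponent M a c = enat 2"
begin

lemmas distinct' = distinct distinct[symmetric]

lemma exponents': "coxeter_exponent M b a = enat 3" "coxeter_exponent M c b = enat 4"
    "coxeter_exponent M c a = enat 2"
  using exponents coxeter_exponent_commute by metis+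

abbreviation L :: "nat \<Rightarrow> nat list set \<Rightarrow> nat list set" where
  "L \<equiv> left_mult M"

lemmas closed = left_mult_closed[OF less(1)] left_mult_closed[OF less(2)] left_mult_closed[OF less(3)]

lemma L_square:
  "X \<in> carrier (weyl_group M) \<Longrightarrow> L a (L a X) = X"
  "X \<in> carrier (weyl_group M) \<Longrightarrow> L b (L b X) = X"
  "X \<in> carrier (weyl_group M) \<Longrightarrow> L c (L c X) = X"
  using foldr_left_mult_trivial[OF weyl_eq.square[OF less(1)]]
    foldr_left_mult_trivial[OF weyl_eq.square[OF less(2)]]
    foldr_left_mult_trivial[OF weyl_eq.square[OF less(3)]] by simp_all

lemma L_bab: "L b (L a (L b X)) = L a (L b (L a X))" if "X \<in> carrier (weyl_group M)"
  using foldr_left_mult_trivial[OF weyl_eq.braid[OF less(1) less(2) distinct(1) exponents(1)],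
      of "L b (L a (L b X))"] that
  by (simp add: closed L_square eval_nat_numeral)

lemma L_ca: "L c (L a X) = L a (L c X)" if "X \<in> carrier (weyl_group M)"
  using foldr_left_mult_trivial[OF weyl_eq.braid[OF less(1) less(3) distinct(3) exponents(3)],
      of "L c (L a X)"] that
  by (simp add: closed L_square eval_nat_numeral)

lemma L_cbcb: "L c (L b (L c (L b X))) = L b (L c (L b (L c X)))" if "X \<in> carrier (weyl_group M)"
  using foldr_left_mult_trivial[OF weyl_eq.braid[OF less(2) less(3) distinct(2) exponents(2)],
      of "L c (L b (L c (L b X)))"] that
  by (simp add: closed L_square eval_nat_numeral)

text \<open>
  With this critical pair the rewriting system for the words in \<open>a\<close>, \<open>b\<close>, \<open>c\<close>, ordered by length
  and then lexicographically, becomes confluent.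
\<close>

lemma L_cbacba:
  "L c (L b (L a (L c (L b (L a X))))) = L b (L c (L b (L a (L c (L b X)))))"
  if "X \<in> carrier (weyl_group M)"
  using L_cbcb[of "L a (L b X)"] that by (simp add: closed L_bab L_ca)

lemmas L_rules = L_square L_bab L_ca L_cbcb L_cbacba

lemma relator_cases:
  assumes "weyl_relator M w" "set w \<subseteq> {a, b, c}"
  shows "w \<in> {[a, a], [b, b], [c, c], [a, c, a, c], [c, a, c, a],
    [a, b, a, b, a, b], [b, a, b, a, b, a], [b, c, b, c, b, c, b, c], [c, b, c, b, c, b, c, b]}"
  using assms(1) unfolding weyl_relator_def
proof (elim disjE exE conjE)
  fix i assume "w = [i, i]"
  then show ?thesis using assms(2) by auto
next
  fix i j m assume *: "i \<noteq> j" "coxeter_exponent M i j = enat m" "w = concat (replicate m [i, j])"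
  have "m \<noteq> 0" using *(2) coxeter_exponent_nonzero[of M i j] by auto
  then have "i \<in> {a, b, c}" "j \<in> {a, b, c}" using *(3) assms(2) by (auto simp: gr0_conv_Suc)
  then show ?thesis
    using *(1) *(2)[symmetric] unfolding *(3)
    by (auto simp: exponents exponents' eval_nat_numeral)
qed

end

text \<open>
  Tables are written with the letters 0, 1, 2 for the generators \<open>a\<close>, \<open>b\<close>, \<open>c\<close> of \<open>B\<^sub>3\<close>: row \<open>k\<close> lists
  what each letter does to coset \<open>k\<close>. \<open>B\<^sub>3\<close> acts on \<open>\<real>\<^sup>3\<close> by signed permutations, with \<open>a\<close> and \<open>b\<close>
  exchanging neighbouring coordinates and \<open>c\<close> changing the sign of the last one. The subgroup
  generated by \<open>b\<close> and \<open>c\<close> is the stabilizer of the first unit vector, whose orbit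
  \<open>\<epsilon>\<^sub>1, \<epsilon>\<^sub>2, \<epsilon>\<^sub>3, -\<epsilon>\<^sub>3, -\<epsilon>\<^sub>2, -\<epsilon>\<^sub>1\<close> is a path.
\<close>

definition path_trans :: "(nat \<times> nat option) list list" where
  "path_trans =
    [[(1, None), (0, Some 1), (0, Some 2)],
     [(0, None), (2, None), (1, Some 2)],
     [(2, Some 1), (1, None), (3, None)],
     [(3, Some 1), (4, None), (2, None)],
     [(5, None), (3, None), (4, Some 2)],
     [(4, None), (5, Some 1), (5, Some 2)]]"

definition path_rep :: "nat list list" where
  "path_rep = [[], [0], [1,0], [2,1,0], [1,2,1,0], [0,1,2,1,0]]"

text \<open>
  The subgroup generated by \<open>a\<close> and \<open>c\<close> is the stabilizer of \<open>\<epsilon>\<^sub>1 + \<epsilon>\<^sub>2\<close>, the weight of the middle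
  node; its orbit consists of the 12 vectors \<open>\<plusminus> \<epsilon>\<^sub>i \<plusminus> \<epsilon>\<^sub>j\<close>.
\<close>

definition middle_trans :: "(nat \<times> nat option) list list" where
  "middle_trans =
    [[(0, Some 0), (1, None), (0, Some 2)],
     [(2, None), (0, None), (3, None)],
     [(1, None), (2, Some 0), (4, None)],
     [(4, None), (5, None), (1, None)],
     [(3, None), (6, None), (2, None)],
     [(7, None), (3, None), (5, Some 2)],
     [(8, None), (4, None), (9, None)],
     [(5, None), (8, None), (7, Some 2)],
     [(6, None), (7, None), (10, None)],
     [(10, None), (9, Some 0), (6, None)],
     [(9, None), (11, None), (8, None)],
     [(11, Some 0), (10, None), (11, Some 2)]]"

definition middle_rep :: "nat list list" where
  "middle_rep = [[], [1], [0,1], [2,1], [2,0,1], [1,2,1], [1,2,0,1], [0,1,2,1], [0,1,2,0,1],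
    [2,1,2,0,1], [2,0,1,2,0,1], [1,2,0,1,2,0,1]]"

text \<open>
  The regular representations of the dihedral group of order 8 generated by \<open>b\<close> and \<open>c\<close>, and of
  the group of order 4 generated by \<open>a\<close> and \<open>c\<close>. The column of the third letter is
  padding.
\<close>

definition bc_step :: "nat list list" where
  "bc_step = [[0,1,2], [0,0,4], [0,3,0], [0,2,6], [0,5,1], [0,4,7], [0,7,3], [0,6,5]]"

definition bc_rep :: "nat list list" where
  "bc_rep = [[], [1], [2], [1,2], [2,1], [1,2,1], [2,1,2], [1,2,1,2]]"

definition ac_step :: "nat list list" where
  "ac_step = [[1,0,2], [0,0,3], [3,0,0], [2,0,1]]"

definition ac_rep :: "nat list list" where
  "ac_rep = [[], [0], [2], [0,2]]"

lemma less_6: "k < 6 \<longleftrightarrow> k \<in> {0, 1, 2, 3, 4, 5::nat}"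
  unfolding insert_iff empty_iff by presburger

lemma less_8: "k < 8 \<longleftrightarrow> k \<in> {0, 1, 2, 3, 4, 5, 6, 7::nat}"
  unfolding insert_iff empty_iff by presburger

lemma less_12: "k < 12 \<longleftrightarrow> k \<in> {0, 1, 2, 3, 4, 5, 6, 7, 8, 9, 10, 11::nat}"
  unfolding insert_iff empty_iff by presburger

lemma less_4: "k < 4 \<longleftrightarrow> k \<in> {0, 1, 2, 3::nat}"
  unfolding insert_iff empty_iff by presburger

context b3
begin

definition letters :: "nat list \<Rightarrow> nat list" where
  "letters = map (\<lambda>l. [a, b, c] ! l)"

definition letter_index :: "nat \<Rightarrow> nat" where
  "letter_index s = (if s = a then 0 else if s = b then 1 else 2)"

definition coset_trans :: "(nat \<times> nat option) list list \<Rightarrow> nat \<Rightarrow> nat \<Rightarrow> nat \<times> nat option" where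
  "coset_trans T s k = (case T ! k ! letter_index s of (k', q) \<Rightarrow> (k', map_option (\<lambda>l. [a, b, c] ! l) q))"

lemma letter_index_simps [simp]: "letter_index a = 0" "letter_index b = 1" "letter_index c = 2"
  using distinct by (auto simp: letter_index_def)

lemma relator_braid:
  "i < dim_row M \<Longrightarrow> j < dim_row M \<Longrightarrow> i \<noteq> j \<Longrightarrow> coxeter_exponent M i j = enat m \<Longrightarrow>
    weyl_relator M (concat (replicate m [i, j]))"
  unfolding weyl_relator_def by blast

lemma relator_simps:
  "weyl_relator M [a, a]" "weyl_relator M [b, b]" "weyl_relator M [c, c]"
  "weyl_relator M [b, c, b, c, b, c, b, c]" "weyl_relator M [c, b, c, b, c, b, c, b]"
  "weyl_relator M [a, c, a, c]" "weyl_relator M [c, a, c, a]"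
  using less relator_braid[OF less(2,3) distinct(2) exponents(2)]
    relator_braid[OF less(3,2) distinct(2)[symmetric] exponents'(2)]
    relator_braid[OF less(1,3) distinct(3) exponents(3)]
    relator_braid[OF less(3,1) distinct(3)[symmetric] exponents'(3)]
  by (simp_all add: weyl_relator_def eval_nat_numeral)

text \<open>
  The conditions on a coset table in a form that rewriting decides row by row: the outcome of a
  step is inspected by a case distinction instead of being assumed to have a certain form.
\<close>

lemma coset_tableI:
  assumes g: "g \<in> {a, b, c}" "base = {a, b, c} - {g}"
    and N: "1 < N"
    and outer: "coset_trans T g 0 = (1, None)"
    and base: "\<And>s. s \<in> base \<Longrightarrow> coset_trans T s 0 = (0, Some s)"
    and step: "\<And>k s. k < N \<Longrightarrow> s \<in> {a, b, c} \<Longrightarrow>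
      (case coset_trans T s k of
        (k', Some q) \<Rightarrow> k' = k \<and> q \<in> base \<and> weyl_eq M (s # letters (R ! k)) (letters (R ! k) @ [q])
      | (k', None) \<Rightarrow> k' < N \<and> (s \<in> base \<longrightarrow> k \<noteq> 0 \<longrightarrow> k' \<noteq> 0) \<and>
          weyl_eq M (s # letters (R ! k)) (letters (R ! k')) \<and> length (R ! k') \<le> Suc (length (R ! k)))"
    and relator: "\<And>w k. w \<in> {[a, a], [b, b], [c, c], [a, c, a, c], [c, a, c, a],
        [a, b, a, b, a, b], [b, a, b, a, b, a], [b, c, b, c, b, c, b, c], [c, b, c, b, c, b, c, b]} \<Longrightarrow>
      k < N \<Longrightarrow> (case run (coset_trans T) w k of (k', p) \<Rightarrow>
        k' = k \<and> (p = [] \<or> weyl_relator M p \<and> set p \<subseteq> base))"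
    and R0: "R ! 0 = []"
    and R: "\<And>k. k < N \<Longrightarrow> set (R ! k) \<subseteq> {..<3} \<and> run (coset_trans T) (letters (R ! k)) 0 = (k, [])"
  shows "coset_table M base g N (coset_trans T) (\<lambda>k. letters (R ! k))"
proof
  have ins: "insert g base = {a, b, c}" using g by auto
  show "g \<notin> base" using g by simp
  show "1 < N" "coset_trans T g 0 = (1, None)" by fact+
  show "coset_trans T s 0 = (0, Some s)" if "s \<in> base" for s by (rule base[OF that])
  show "letters (R ! 0) = []" by (simp add: letters_def R0)
  show "k' = k \<and> q \<in> base \<and> weyl_eq M (s # letters (R ! k)) (letters (R ! k) @ [q])"
    if "k < N" "s \<in> insert g base" "coset_trans T s k = (k', Some q)" for k s k' q
    using step[OF that(1) that(2)[unfolded ins]] that(3) by simp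
  show "k' < N \<and> (s \<in> base \<longrightarrow> k \<noteq> 0 \<longrightarrow> k' \<noteq> 0) \<and>
      weyl_eq M (s # letters (R ! k)) (letters (R ! k')) \<and>
      length (letters (R ! k')) \<le> Suc (length (letters (R ! k)))"
    if "k < N" "s \<in> insert g base" "coset_trans T s k = (k', None)" for k s k'
    using step[OF that(1) that(2)[unfolded ins]] that(3) by (simp add: letters_def)
  show "\<exists>p. run (coset_trans T) w k = (k, p) \<and> (p = [] \<or> weyl_relator M p \<and> set p \<subseteq> base)"
    if "weyl_relator M w" "set w \<subseteq> insert g base" "k < N" for w k
    using relator[OF relator_cases[OF that(1) that(2)[unfolded ins]] that(3)] by auto
  show "set (letters (R ! k)) \<subseteq> insert g base \<and> run (coset_trans T) (letters (R ! k)) 0 = (k, [])"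
    if "k < N" for k
  proof -
    have "[a, b, c] ! l \<in> {a, b, c}" if "l < 3" for l
      using that nth_mem[of l "[a, b, c]"] by simp
    then show ?thesis using R[OF that] unfolding ins letters_def by fastforce
  qed
qed

lemma path_table: "coset_table M {b, c} a 6 (coset_trans path_trans) (\<lambda>k. letters (path_rep ! k))"
proof (rule coset_tableI)
  fix k s
  assume "k < (6::nat)" "s \<in> {a, b, c}"
  then show "case coset_trans path_trans s k of
        (k', Some q) \<Rightarrow> k' = k \<and> q \<in> {b, c} \<and>
          weyl_eq M (s # letters (path_rep ! k)) (letters (path_rep ! k) @ [q])
      | (k', None) \<Rightarrow> k' < 6 \<and> (s \<in> {b, c} \<longrightarrow> k \<noteq> 0 \<longrightarrow> k' \<noteq> 0) \<and>
          weyl_eq M (s # letters (path_rep ! k)) (letters (path_rep ! k')) \<and>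
          length (path_rep ! k') \<le> Suc (length (path_rep ! k))"
    unfolding less_6
    by (elim insertE emptyE) (simp_all add: coset_trans_def path_trans_def path_rep_def letters_def
        less closed L_rules weyl_eq_left_multI distinct')
next
  fix w and k :: nat
  assume "w \<in> {[a, a], [b, b], [c, c], [a, c, a, c], [c, a, c, a],
    [a, b, a, b, a, b], [b, a, b, a, b, a], [b, c, b, c, b, c, b, c], [c, b, c, b, c, b, c, b]}" "k < 6"
  then show "case run (coset_trans path_trans) w k of (k', p) \<Rightarrow>
      k' = k \<and> (p = [] \<or> weyl_relator M p \<and> set p \<subseteq> {b, c})"
    unfolding less_6
    by (elim insertE emptyE) (simp_all add: coset_trans_def path_trans_def relator_simps)
next
  fix k :: nat assume "k < 6"
  then show "set (path_rep ! k) \<subseteq> {..<3} \<and> run (coset_trans path_trans) (letters (path_rep ! k)) 0 = (k, [])"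
    unfolding less_6
    by (elim insertE emptyE) (simp_all add: coset_trans_def path_trans_def path_rep_def letters_def)
qed (use distinct' in \<open>auto simp: coset_trans_def path_trans_def path_rep_def\<close>)

lemma middle_table: "coset_table M {a, c} b 12 (coset_trans middle_trans) (\<lambda>k. letters (middle_rep ! k))"
proof (rule coset_tableI)
  fix k s
  assume "k < (12::nat)" "s \<in> {a, b, c}"
  then show "case coset_trans middle_trans s k of
        (k', Some q) \<Rightarrow> k' = k \<and> q \<in> {a, c} \<and>
          weyl_eq M (s # letters (middle_rep ! k)) (letters (middle_rep ! k) @ [q])
      | (k', None) \<Rightarrow> k' < 12 \<and> (s \<in> {a, c} \<longrightarrow> k \<noteq> 0 \<longrightarrow> k' \<noteq> 0) \<and>
          weyl_eq M (s # letters (middle_rep ! k)) (letters (middle_rep ! k')) \<and>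
          length (middle_rep ! k') \<le> Suc (length (middle_rep ! k))"
    unfolding less_12
    by (elim insertE emptyE) (simp_all add: coset_trans_def middle_trans_def middle_rep_def letters_def
        less closed L_rules weyl_eq_left_multI distinct')
next
  fix w and k :: nat
  assume "w \<in> {[a, a], [b, b], [c, c], [a, c, a, c], [c, a, c, a],
    [a, b, a, b, a, b], [b, a, b, a, b, a], [b, c, b, c, b, c, b, c], [c, b, c, b, c, b, c, b]}" "k < 12"
  then show "case run (coset_trans middle_trans) w k of (k', p) \<Rightarrow>
      k' = k \<and> (p = [] \<or> weyl_relator M p \<and> set p \<subseteq> {a, c})"
    unfolding less_12
    by (elim insertE emptyE) (simp_all add: coset_trans_def middle_trans_def relator_simps)
next
  fix k :: nat assume "k < 12"
  then show "set (middle_rep ! k) \<subseteq> {..<3} \<and> run (coset_trans middle_trans) (letters (middle_rep ! k)) 0 = (k, [])"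
    unfolding less_12
    by (elim insertE emptyE) (simp_all add: coset_trans_def middle_trans_def middle_rep_def letters_def)
qed (use distinct' in \<open>auto simp: coset_trans_def middle_trans_def middle_rep_def\<close>)

definition table_step :: "nat list list \<Rightarrow> nat \<Rightarrow> nat \<Rightarrow> nat" where
  "table_step T s k = T ! k ! letter_index s"

lemma bc_table: "base_table M {b, c} 8 (table_step bc_step) (\<lambda>k. letters (bc_rep ! k))"
proof
  fix k s assume "k < (8::nat)" "s \<in> {b, c}"
  then show "table_step bc_step s k < 8 \<and>
      weyl_eq M (s # letters (bc_rep ! k)) (letters (bc_rep ! table_step bc_step s k)) \<and>
      length (letters (bc_rep ! table_step bc_step s k)) \<le> Suc (length (letters (bc_rep ! k)))"
    unfolding less_8
    by (elim insertE emptyE) (simp_all add: table_step_def bc_step_def bc_rep_def letters_def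
        less closed L_rules weyl_eq_left_multI)
next
  fix w and k :: nat assume w: "weyl_relator M w" "set w \<subseteq> {b, c}" "k < 8"
  have abc: "set w \<subseteq> {a, b, c}" using w(2) by blast
  from w(2) have "w \<in> {[b, b], [c, c], [b, c, b, c, b, c, b, c], [c, b, c, b, c, b, c, b]}"
    using relator_cases[OF w(1) abc] distinct' by auto
  with w(3) show "foldr (table_step bc_step) w k = k"
    unfolding less_8 by (elim insertE emptyE) (simp_all add: table_step_def bc_step_def)
next
  fix k :: nat assume "k < 8"
  then show "set (letters (bc_rep ! k)) \<subseteq> {b, c} \<and> foldr (table_step bc_step) (letters (bc_rep ! k)) 0 = k"
    unfolding less_8
    by (elim insertE emptyE) (simp_all add: table_step_def bc_step_def bc_rep_def letters_def)
qed (simp_all add: bc_rep_def letters_def)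

lemma ac_table: "base_table M {a, c} 4 (table_step ac_step) (\<lambda>k. letters (ac_rep ! k))"
proof
  fix k s assume "k < (4::nat)" "s \<in> {a, c}"
  then show "table_step ac_step s k < 4 \<and>
      weyl_eq M (s # letters (ac_rep ! k)) (letters (ac_rep ! table_step ac_step s k)) \<and>
      length (letters (ac_rep ! table_step ac_step s k)) \<le> Suc (length (letters (ac_rep ! k)))"
    unfolding less_4
    by (elim insertE emptyE) (simp_all add: table_step_def ac_step_def ac_rep_def letters_def
        less closed L_rules weyl_eq_left_multI)
next
  fix w and k :: nat assume w: "weyl_relator M w" "set w \<subseteq> {a, c}" "k < 4"
  have abc: "set w \<subseteq> {a, b, c}" using w(2) by blast
  from w(2) have "w \<in> {[a, a], [c, c], [a, c, a, c], [c, a, c, a]}"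
    using relator_cases[OF w(1) abc] distinct' by auto
  with w(3) show "foldr (table_step ac_step) w k = k"
    unfolding less_4 by (elim insertE emptyE) (simp_all add: table_step_def ac_step_def)
next
  fix k :: nat assume "k < 4"
  then show "set (letters (ac_rep ! k)) \<subseteq> {a, c} \<and> foldr (table_step ac_step) (letters (ac_rep ! k)) 0 = k"
    unfolding less_4
    by (elim insertE emptyE) (simp_all add: table_step_def ac_step_def ac_rep_def letters_def)
qed (simp_all add: ac_rep_def letters_def)

end

section \<open>Poincare series of the two amalgams\<close>

lemma (in b3) length_letters [simp]: "length (letters w) = length w"
  by (simp add: letters_def)

text \<open>
  Two copies of \<open>B\<^sub>3\<close> amalgamated along the dihedral group of their double bonds. The second copy
  runs through the double bond in the opposite direction.
\<close>

lemma poincare_path_amalgam: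
  assumes "b3 M a b c" "b3 M a' c b" and M: "{..<dim_row M} = {a, a', b, c}"
    and "a \<noteq> a'" "coxeter_exponent M a a' = \<infinity>"
  defines "A \<equiv> fps_X + fps_X ^ 2 + fps_X ^ 3 + fps_X ^ 4 + fps_X ^ 5"
  shows "poincare_series M * (1 - A) =
    (1 + fps_X) * (1 + fps_X + fps_X ^ 2 + fps_X ^ 3) * (1 + A)"
proof -
  interpret T: b3 M a b c by fact
  interpret F: b3 M a' c b by fact
  interpret coxeter_amalgam M "{b, c}" 8 "T.table_step bc_step" "\<lambda>k. T.letters (bc_rep ! k)"
    "\<lambda>d. if d then a else a'" 6
    "\<lambda>d. if d then T.coset_trans path_trans else F.coset_trans path_trans"
    "\<lambda>d k. if d then T.letters (path_rep ! k) else F.letters (path_rep ! k)"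
  proof (intro coxeter_amalgam.intro T.bc_table coxeter_amalgam_axioms.intro)
    fix d
    show "coset_table M {b, c} (if d then a else a') 6
        (if d then T.coset_trans path_trans else F.coset_trans path_trans)
        (\<lambda>k. if d then T.letters (path_rep ! k) else F.letters (path_rep ! k))"
      using T.path_table F.path_table by (cases d) (simp_all add: insert_commute)
    show "coxeter_exponent M (if d then a else a') (if \<not> d then a else a') = \<infinity>"
      using assms(5) coxeter_exponent_commute[of M a a'] by simp
  qed (use assms(4) M in \<open>auto simp: UNIV_bool\<close>)
  have eq: "{1..<6::nat} = {1,2,3,4,5}" "{..<8::nat} = {0,1,2,3,4,5,6,7}"
    by (auto simp: less_6 less_8)
  have c: "coset_series d = A" for d
    unfolding coset_series_def eq by (cases d; simp add: path_rep_def A_def) (simp_all add: numeral_eq_Suc monom_Suc monom_0)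
  have b: "base_series = (1 + fps_X) * (1 + fps_X + fps_X ^ 2 + fps_X ^ 3)"
    unfolding base_series_def eq by (simp add: bc_rep_def algebra_simps eval_nat_numeral)
  have "fps_nth (1 + A) 0 \<noteq> 0" by (simp add: A_def)
  then have "1 + A \<noteq> 0" by (metis fps_zero_nth)
  have "(poincare_series M * (1 - A)) * (1 + A) = (base_series * (1 + A)) * (1 + A)"
    using poincare_amalgam by (simp add: c algebra_simps)
  then show ?thesis
    unfolding b using \<open>1 + A \<noteq> 0\<close> by simp
qed

text \<open>
  Two copies of \<open>B\<^sub>3\<close> amalgamated along the two commuting end nodes.
\<close>

lemma poincare_middle_amalgam:
  assumes "b3 M a b c" "b3 M a b' c" and M: "{..<dim_row M} = {a, b, b', c}"
    and "b \<noteq> b'" "coxeter_exponent M b b' = \<infinity>"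
  defines "A \<equiv> fps_X + 2 * fps_X ^ 2 + 2 * fps_X ^ 3 + 2 * fps_X ^ 4 + 2 * fps_X ^ 5 + fps_X ^ 6 + fps_X ^ 7"
  shows "poincare_series M * (1 - A) = (1 + fps_X) ^ 2 * (1 + A)"
proof -
  interpret T: b3 M a b c by fact
  interpret F: b3 M a b' c by fact
  interpret coxeter_amalgam M "{a, c}" 4 "T.table_step ac_step" "\<lambda>k. T.letters (ac_rep ! k)"
    "\<lambda>d. if d then b else b'" 12
    "\<lambda>d. if d then T.coset_trans middle_trans else F.coset_trans middle_trans"
    "\<lambda>d k. if d then T.letters (middle_rep ! k) else F.letters (middle_rep ! k)"
  proof (intro coxeter_amalgam.intro T.ac_table coxeter_amalgam_axioms.intro)
    fix d
    show "coset_table M {a, c} (if d then b else b') 12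
        (if d then T.coset_trans middle_trans else F.coset_trans middle_trans)
        (\<lambda>k. if d then T.letters (middle_rep ! k) else F.letters (middle_rep ! k))"
      using T.middle_table F.middle_table by (cases d) simp_all
    show "coxeter_exponent M (if d then b else b') (if \<not> d then b else b') = \<infinity>"
      using assms(5) coxeter_exponent_commute[of M b b'] by simp
  qed (use assms(4) M in \<open>auto simp: UNIV_bool\<close>)
  have eq: "{1..<12::nat} = {1,2,3,4,5,6,7,8,9,10,11}" "{..<4::nat} = {0,1,2,3}"
    by (auto simp: less_12 less_4)
  have c: "coset_series d = A" for d
    unfolding coset_series_def eq by (cases d; simp add: middle_rep_def A_def) (simp_all add: numeral_eq_Suc monom_Suc monom_0)
  have b: "base_series = (1 + fps_X) ^ 2"
    unfolding base_series_def eq by (simp add: ac_rep_def algebra_simps power2_eq_square)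
  have "fps_nth (1 + A) 0 \<noteq> 0" by (simp add: A_def)
  then have "1 + A \<noteq> 0" by (metis fps_zero_nth)
  have "(poincare_series M * (1 - A)) * (1 + A) = (base_series * (1 + A)) * (1 + A)"
    using poincare_amalgam by (simp add: c algebra_simps)
  then show ?thesis
    unfolding b using \<open>1 + A \<noteq> 0\<close> by simp
qed

section \<open>The two matrices\<close>

lemma dim_AB [simp]: "dim_row matrix_A = 4" "dim_col matrix_A = 4" "dim_row matrix_B = 4" "dim_col matrix_B = 4"
  by (simp_all add: matrix_A_def matrix_B_def mat_of_rows_list_def)

lemma matrix_A_index:
  "i < 4 \<Longrightarrow> j < 4 \<Longrightarrow> matrix_A $$ (i, j) =
    [[ 2, -1,  0, -1], [-4,  2, -1,  0], [ 0, -1,  2, -1], [-1,  0, -2,  2]] ! i ! j"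
  by (simp add: matrix_A_def mat_of_rows_list_def)

lemma matrix_B_index:
  "i < 4 \<Longrightarrow> j < 4 \<Longrightarrow> matrix_B $$ (i, j) =
    [[ 2, -1, -1,  0], [-1,  2, -1, -1], [-1, -4,  2, -1], [ 0, -2, -2,  2]] ! i ! j"
  by (simp add: matrix_B_def mat_of_rows_list_def)

lemma all_less_4: "(\<forall>i<4. P i) \<longleftrightarrow> P 0 \<and> P 1 \<and> P 2 \<and> P (3::nat)"
  by (auto simp: less_4)

lemma sum_less_4: "(\<Sum>j<4::nat. f j) = f 0 + f 1 + f 2 + f 3"
  by (simp add: numeral_eq_Suc)

lemma cartan_AB: "cartan_matrix matrix_A" "cartan_matrix matrix_B"
  unfolding cartan_matrix_def square_mat.simps dim_AB all_less_4
  by (simp_all add: matrix_A_index matrix_B_index)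

lemma connected_if_path:
  assumes "\<And>i. i < dim_row M \<Longrightarrow> (0, i) \<in> (coxeter_edges M)\<^sup>* \<and> (i, 0) \<in> (coxeter_edges M)\<^sup>*"
  shows "connected_coxeter_graph M"
  unfolding connected_coxeter_graph_def using assms by (meson rtrancl_trans)

lemma connected_A: "connected_coxeter_graph matrix_A"
proof (rule connected_if_path)
  have e: "(0, 1) \<in> coxeter_edges matrix_A" "(1, 2) \<in> coxeter_edges matrix_A"
      "(2, 3) \<in> coxeter_edges matrix_A" "(3, 0) \<in> coxeter_edges matrix_A"
    by (simp_all add: coxeter_edges_def matrix_A_index)
  note r = e[THEN r_into_rtrancl]
  have "\<forall>i<4. (0, i) \<in> (coxeter_edges matrix_A)\<^sup>* \<and> (i, 0) \<in> (coxeter_edges matrix_A)\<^sup>*"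
    unfolding all_less_4 using r by (meson rtrancl_refl rtrancl_trans)
  then show "(0, i) \<in> (coxeter_edges matrix_A)\<^sup>* \<and> (i, 0) \<in> (coxeter_edges matrix_A)\<^sup>*"
    if "i < dim_row matrix_A" for i using that by simp
qed

lemma connected_B: "connected_coxeter_graph matrix_B"
proof (rule connected_if_path)
  have e: "(0, 1) \<in> coxeter_edges matrix_B" "(1, 3) \<in> coxeter_edges matrix_B"
      "(3, 2) \<in> coxeter_edges matrix_B" "(2, 0) \<in> coxeter_edges matrix_B"
    by (simp_all add: coxeter_edges_def matrix_B_index)
  note r = e[THEN r_into_rtrancl]
  have "\<forall>i<4. (0, i) \<in> (coxeter_edges matrix_B)\<^sup>* \<and> (i, 0) \<in> (coxeter_edges matrix_B)\<^sup>*"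
    unfolding all_less_4 using r by (meson rtrancl_refl rtrancl_trans)
  then show "(0, i) \<in> (coxeter_edges matrix_B)\<^sup>* \<and> (i, 0) \<in> (coxeter_edges matrix_B)\<^sup>*"
    if "i < dim_row matrix_B" for i using that by simp
qed

text \<open>
  Both matrices have nonpositive column sums, so the inequalities \<open>M p \<ge> 0\<close> for \<open>p \<ge> 0\<close> add up to
  equalities, and \<open>p = 0\<close> is a matter of linear arithmetic.
\<close>

lemma infinite_dim_A: "kac_moody_infinite_dim matrix_A"
proof (rule kac_moody_infinite_dimI)
  fix p :: "nat \<Rightarrow> int"
  assume p: "\<And>j. p j \<ge> 0"
    and "\<And>i. i < dim_row matrix_A \<Longrightarrow> (\<Sum>j<dim_row matrix_A. matrix_A $$ (i, j) * p j) \<ge> 0"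
  then have "\<forall>i<4. (\<Sum>j<4. matrix_A $$ (i, j) * p j) \<ge> 0" by simp
  then show "(\<Sum>j<dim_row matrix_A. p j) = 0"
    using p[of 0] p[of 1] p[of 2] p[of 3]
    unfolding all_less_4 dim_AB sum_less_4 by (simp add: matrix_A_index)
qed (simp_all add: cartan_AB)

lemma infinite_dim_B: "kac_moody_infinite_dim matrix_B"
proof (rule kac_moody_infinite_dimI)
  fix p :: "nat \<Rightarrow> int"
  assume p: "\<And>j. p j \<ge> 0"
    and "\<And>i. i < dim_row matrix_B \<Longrightarrow> (\<Sum>j<dim_row matrix_B. matrix_B $$ (i, j) * p j) \<ge> 0"
  then have "\<forall>i<4. (\<Sum>j<4. matrix_B $$ (i, j) * p j) \<ge> 0" by simp
  then show "(\<Sum>j<dim_row matrix_B. p j) = 0"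
    using p[of 0] p[of 1] p[of 2] p[of 3]
    unfolding all_less_4 dim_AB sum_less_4 by (simp add: matrix_B_index)
qed (simp_all add: cartan_AB)

lemma lessThan_4: "{..<4::nat} = {0, 1, 2, 3}" by auto

lemma poincare_A:
  defines "t \<equiv> fps_X :: rat fps"
  shows "poincare_series matrix_A * (t^5 + t^4 + t^3 + t^2 + t - 1) =
    - ((t^5 + t^4 + t^3 + t^2 + t + 1) * (t^3 + t^2 + t + 1) * (t + 1))"
proof -
  have "poincare_series matrix_A * (1 - (t + t ^ 2 + t ^ 3 + t ^ 4 + t ^ 5)) =
    (1 + t) * (1 + t + t ^ 2 + t ^ 3) * (1 + (t + t ^ 2 + t ^ 3 + t ^ 4 + t ^ 5))"
    unfolding t_def
  proof (rule poincare_path_amalgam)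
    show "b3 matrix_A 0 3 2" "b3 matrix_A 1 2 3"
      by unfold_locales (simp_all add: coxeter_exponent_def matrix_A_index numeral_eq_enat)
    show "coxeter_exponent matrix_A 0 1 = \<infinity>"
      by (simp add: coxeter_exponent_def matrix_A_index)
  qed (auto simp: lessThan_4)
  then show ?thesis by (simp add: algebra_simps)
qed

lemma poincare_B:
  defines "t \<equiv> fps_X :: rat fps"
  shows "poincare_series matrix_B * (t^7 + t^6 + 2 * t^5 + 2 * t^4 + 2 * t^3 + 2 * t^2 + t - 1) =
    - ((t^5 + t^4 + t^3 + t^2 + t + 1) * (t^3 + t^2 + t + 1) * (t + 1))"
proof -
  let ?A = "t + 2 * t ^ 2 + 2 * t ^ 3 + 2 * t ^ 4 + 2 * t ^ 5 + t ^ 6 + t ^ 7"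
  have "poincare_series matrix_B * (1 - ?A) = (1 + t) ^ 2 * (1 + ?A)"
    unfolding t_def
  proof (rule poincare_middle_amalgam)
    show "b3 matrix_B 0 1 3" "b3 matrix_B 0 2 3"
      by unfold_locales (simp_all add: coxeter_exponent_def matrix_B_index numeral_eq_enat)
    show "coxeter_exponent matrix_B 1 2 = \<infinity>"
      by (simp add: coxeter_exponent_def matrix_B_index)
  qed (auto simp: lessThan_4)
  moreover have "(1 + t) ^ 2 * (1 + ?A) =
      (t^5 + t^4 + t^3 + t^2 + t + 1) * (t^3 + t^2 + t + 1) * (t + 1)"
  proof -
    have "(1 + t) * (1 + ?A) = (t^5 + t^4 + t^3 + t^2 + t + 1) * (t^3 + t^2 + t + 1)"
      by (simp add: algebra_simps eval_nat_numeral)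
    then show ?thesis by (simp add: power2_eq_square mult.assoc add.commute mult.commute)
  qed
  moreover have "1 - ?A = - (t^7 + t^6 + 2 * t^5 + 2 * t^4 + 2 * t^3 + 2 * t^2 + t - 1)"
    by simp
  ultimately show ?thesis by (simp only: mult_minus_right) (metis minus_minus)
qed

lemma rational_degree_minus_div:
  fixes P :: "rat fps"
  assumes "P * fps_of_poly R = - fps_of_poly Q" "poly Q 0 \<noteq> 0" "poly R 0 \<noteq> 0"
  shows "P = - (fps_of_poly Q / fps_of_poly R)"
    "rational_degree P = int (Polynomial.degree Q) - int (Polynomial.degree R)"
proof -
  have nz: "Q \<noteq> 0" "R \<noteq> 0" using assms by auto
  have "- P * fps_of_poly R = fps_of_poly Q" using assms(1) by simp
  then have "fps_of_poly Q / fps_of_poly R = - P"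
    using nz by (metis fps_of_poly_eq_iff fps_of_poly_0 nonzero_mult_div_cancel_right)
  then show "P = - (fps_of_poly Q / fps_of_poly R)" by simp
  show "rational_degree P = int (Polynomial.degree Q) - int (Polynomial.degree R)"
    using rational_degree_eqI[of "- Q" R P] assms(1) nz by (simp add: fps_of_poly_uminus)
qed

theorem mainTheorem6:
  shows "let t = (fps_X :: rat fps) in
    poincare_series matrix_A =
      - ((t^5 + t^4 + t^3 + t^2 + t + 1) * (t^3 + t^2 + t + 1) * (t + 1)
          / (t^5 + t^4 + t^3 + t^2 + t - 1)) \<and>
    poincare_series matrix_B =
      - ((t^5 + t^4 + t^3 + t^2 + t + 1) * (t^3 + t^2 + t + 1) * (t + 1)
          / (t^7 + t^6 + 2 * t^5 + 2 * t^4 + 2 * t^3 + 2 * t^2 + t - 1)) \<and>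
    rational_degree (poincare_series matrix_A) = 4 \<and>
    rational_degree (poincare_series matrix_B) = 2 \<and>
    CLS_counterexample matrix_A \<and>
    CLS_counterexample matrix_B \<and>
    \<not> CLS_conjecture"
proof -
  let ?Q = "[:1,1,1,1,1,1:] * [:1,1,1,1:] * [:1,1:] :: rat poly"
  let ?RA = "[:-1,1,1,1,1,1:] :: rat poly"
  let ?RB = "[:-1,1,2,2,2,2,1,1:] :: rat poly"
  let ?t = "fps_X :: rat fps"
  have "fps_of_poly [:1,1,1,1,1,1:] = ?t^5 + ?t^4 + ?t^3 + ?t^2 + ?t + 1"
    "fps_of_poly [:1,1,1,1:] = ?t^3 + ?t^2 + ?t + 1" "fps_of_poly [:1,1:] = ?t + 1"
    by (simp_all add: fps_of_poly_pCons) (simp_all add: numeral_eq_Suc algebra_simps monom_Suc monom_0)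
  then have Q: "fps_of_poly ?Q =
      (?t^5 + ?t^4 + ?t^3 + ?t^2 + ?t + 1) * (?t^3 + ?t^2 + ?t + 1) * (?t + 1)"
    by (simp only: fps_of_poly_mult)
  have RA: "fps_of_poly ?RA = ?t^5 + ?t^4 + ?t^3 + ?t^2 + ?t - 1"
    by (simp add: fps_of_poly_pCons) (simp add: numeral_eq_Suc algebra_simps monom_Suc monom_0)
  have RB: "fps_of_poly ?RB = ?t^7 + ?t^6 + 2 * ?t^5 + 2 * ?t^4 + 2 * ?t^3 + 2 * ?t^2 + ?t - 1"
    by (simp add: fps_of_poly_pCons) (simp add: numeral_eq_Suc algebra_simps monom_Suc monom_0)
  have deg: "Polynomial.degree ?Q = 9" by (simp add: degree_mult_eq)
  note A = rational_degree_minus_div[of "poincare_series matrix_A" ?RA ?Q, unfolded Q RA deg, OF poincare_A]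
  note B = rational_degree_minus_div[of "poincare_series matrix_B" ?RB ?Q, unfolded Q RB deg, OF poincare_B]
  have dA: "rational_degree (poincare_series matrix_A) = 4"
    using A(2) by simp
  have dB: "rational_degree (poincare_series matrix_B) = 2"
    using B(2) by simp
  have cA: "CLS_counterexample matrix_A"
    by (simp add: CLS_counterexample_def cartan_AB infinite_dim_A connected_A dA)
  have cB: "CLS_counterexample matrix_B"
    by (simp add: CLS_counterexample_def cartan_AB infinite_dim_B connected_B dB)
  have "\<not> CLS_conjecture"
    using cA unfolding CLS_counterexample_def CLS_conjecture_def by blast
  moreover have "poincare_series matrix_A = - ((?t^5 + ?t^4 + ?t^3 + ?t^2 + ?t + 1) *
      (?t^3 + ?t^2 + ?t + 1) * (?t + 1) / (?t^5 + ?t^4 + ?t^3 + ?t^2 + ?t - 1))"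
    by (rule A(1)) simp_all
  moreover have "poincare_series matrix_B = - ((?t^5 + ?t^4 + ?t^3 + ?t^2 + ?t + 1) *
      (?t^3 + ?t^2 + ?t + 1) * (?t + 1) /
      (?t^7 + ?t^6 + 2 * ?t^5 + 2 * ?t^4 + 2 * ?t^3 + 2 * ?t^2 + ?t - 1))"
    by (rule B(1)) simp_all
  ultimately show ?thesis
    unfolding Let_def using dA dB cA cB by blast
qed

end
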